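(* Let $N\ge 1$, $0<s<1$, $2<p<\infty$, and let $\Omega\subset\mathbb{R}^N$ be a bounded domain with smooth boundary. Let $F$ be the unique positive solution of $\mathcal{L}_{p,s}F=\frac{1}{p-2}F$ in $\Omega$, $F=0$ in $\mathbb{R}^N\setminus\Omega$, so that $U(x,t):=t^{-1/(p-2)}F(x)$ solves $\partial_tU+\mathcal{L}_{p,s}U=0$ in $\Omega\times(0,\infty)$ with $U=0$ outside $\Omega$. Then for every nonnegative solution $u(x,t)$ of the problem $$\partial_t u+\mathcal{L}_{p,s}u=0 \ \text{ in } \Omega\times(0,\infty),\qquad u(\cdot,0)=u_0 \ \text{ in } \Omega,\qquad u(x,t)=0 \ \text{ for } x\in\mathbb{R}^N\setminus\Omega,\ t>0,$$ with initial data $u_0$ in some $L^r(\Omega)$, $1\le r\le\infty$, we have $$u(x,t)\le U(x,t)=t^{-1/(p-2)}F(x)$$ for $x\in\Omega$, $t>0$.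
   Context: Functions on $\Omega$ are extended by zero to $\mathbb{R}^N\setminus\Omega$. Let $$J_{p,s}(u)=\frac1p\int_{\mathbb{R}^N}\int_{\mathbb{R}^N}\frac{|u(x)-u(y)|^p}{|x-y|^{N+sp}}\,dx\,dy ,$$ and let $W^{s,p}_0(\Omega)$ be the closure of $C_c^\infty(\Omega)$ in the norm given by $\|u\|^p=J_{p,s}(u)+\int_{\mathbb{R}^N}|u|^p\,dx$. The fractional $p$-Laplacian is $$\mathcal{L}_{p,s}u(x)=2\,\mathrm{p.v.}\int_{\mathbb{R}^N}\frac{|u(x)-u(y)|^{p-2}(u(x)-u(y))}{|x-y|^{N+sp}}\,dy,\qquad x\in\Omega,$$ understood on $\Omega$ as the sub-differential in $L^2(\Omega)$ of $J_{p,s}$ (defined on $W^{s,p}_0(\Omega)$, and $+\infty$ elsewhere): $\mathcal{L}_{p,s}u=w\in L^2(\Omega)$ means $u\in W^{s,p}_0(\Omega)$ and $$\int_{\mathbb{R}^N}\int_{\mathbb{R}^N}\frac{|u(x)-u(y)|^{p-2}(u(x)-u(y))(\phi(x)-\phi(y))}{|x-y|^{N+sp}}\,dx\,dy=\int_\Omega w\,\phi\,dx\quad\text{for all }\phi\in W^{s,p}_0(\Omega).$$ For $u_0\in L^2(\Omega)$ the solution is the unique strong solution $u\in C([0,\infty);L^2(\Omega))$ given by the semigroup generated by this maximal monotone operator ($\mathcal{L}_{p,s}u(t)\in L^2(\Omega)$ for all $t>0$ and $du/dt=-\mathcal{L}_{p,s}u$ for a.e. $t>0$). This semigroup is order preserving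 and contractive in the $L^1(\Omega)$ norm; for $u_0\in L^1(\Omega)$ the solution is defined by extending the semigroup to $L^1(\Omega)$ by $L^1$-contractivity. The function $F$ exists and is unique, is positive in $\Omega$, Hölder continuous, and vanishes on $\partial\Omega$. *)

theory Defs
  imports "HOL-Analysis.Analysis"
begin

section \<open>Smooth functions and smooth bounded domains\<close>

primrec Ck_on :: "nat \<Rightarrow> 'a::real_normed_vector set \<Rightarrow> ('a \<Rightarrow> 'b::real_normed_vector) \<Rightarrow> bool" where
  "Ck_on 0 S f \<longleftrightarrow> continuous_on S f"
| "Ck_on (Suc k) S f \<longleftrightarrow>
     (\<forall>x\<in>S. f differentiable (at x)) \<and> (\<forall>v. Ck_on k S (\<lambda>x. frechet_derivative f (at x) v))"

definition smooth_on :: "'a::real_normed_vector set \<Rightarrow> ('a \<Rightarrow> 'b::real_normed_vector) \<Rightarrow> bool" where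
  "smooth_on S f \<longleftrightarrow> (\<forall>k. Ck_on k S f)"

definition test_functions :: "'a::euclidean_space set \<Rightarrow> ('a \<Rightarrow> real) set" where
  "test_functions \<Omega> =
     {\<phi>. smooth_on UNIV \<phi> \<and> compact (closure {x. \<phi> x \<noteq> 0}) \<and> closure {x. \<phi> x \<noteq> 0} \<subseteq> \<Omega>}"

text \<open>Near each boundary point the domain is the negativity set of a smooth function \<open>\<rho>\<close> with
  nonvanishing gradient; the boundary is then \<open>{\<rho> = 0}\<close> there.\<close>

definition smooth_boundary :: "'a::euclidean_space set \<Rightarrow> bool" where
  "smooth_boundary \<Omega> \<longleftrightarrow>
     (\<forall>x0\<in>frontier \<Omega>. \<exists>V (\<rho> :: 'a \<Rightarrow> real). open V \<and> x0 \<in> V \<and> smooth_on V \<rho> \<and>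
        (\<forall>x\<in>V. frechet_derivative \<rho> (at x) \<noteq> (\<lambda>v. 0)) \<and> \<Omega> \<inter> V = {x\<in>V. \<rho> x < 0})"

definition smooth_bounded_domain :: "'a::euclidean_space set \<Rightarrow> bool" where
  "smooth_bounded_domain \<Omega> \<longleftrightarrow>
     open \<Omega> \<and> connected \<Omega> \<and> \<Omega> \<noteq> {} \<and> bounded \<Omega> \<and> smooth_boundary \<Omega>"


section \<open>Function spaces\<close>

text \<open>Elements of Lebesgue and Sobolev spaces are represented by Borel functions on the whole
  space that vanish outside \<open>\<Omega>\<close> (extension by zero); almost-everywhere equal functions represent
  the same element.\<close>

definition Lr_space :: "ereal \<Rightarrow> 'a::euclidean_space set \<Rightarrow> ('a \<Rightarrow> real) set" where
  "Lr_space r \<Omega> = {f \<in> borel_measurable borel. (\<forall>x. x \<notin> \<Omega> \<longrightarrow> f x = 0) \<and>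
     (if r = \<infinity> then \<exists>C. AE x in lborel. \<bar>f x\<bar> \<le> C
      else integrable lborel (\<lambda>x. \<bar>f x\<bar> powr real_of_ereal r))}"

definition L1_norm :: "('a::euclidean_space \<Rightarrow> real) \<Rightarrow> real" where
  "L1_norm f = (LINT x|lborel. \<bar>f x\<bar>)"

definition L2_norm :: "('a::euclidean_space \<Rightarrow> real) \<Rightarrow> real" where
  "L2_norm f = sqrt (LINT x|lborel. (f x)\<^sup>2)"

definition J_energy :: "real \<Rightarrow> real \<Rightarrow> ('a::euclidean_space \<Rightarrow> real) \<Rightarrow> ennreal" where
  "J_energy p s u = ennreal (1 / p) *
     (\<integral>\<^sup>+(x, y). ennreal (\<bar>u x - u y\<bar> powr p / norm (x - y) powr (real DIM('a) + s * p))
        \<partial>(lborel \<Otimes>\<^sub>M lborel))"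

text \<open>The \<open>p\<close>-th power of the norm of the fractional Sobolev space.\<close>

definition W_norm_p :: "real \<Rightarrow> real \<Rightarrow> ('a::euclidean_space \<Rightarrow> real) \<Rightarrow> ennreal" where
  "W_norm_p p s u = J_energy p s u + (\<integral>\<^sup>+x. ennreal (\<bar>u x\<bar> powr p) \<partial>lborel)"

definition W0_space :: "real \<Rightarrow> real \<Rightarrow> 'a::euclidean_space set \<Rightarrow> ('a \<Rightarrow> real) set" where
  "W0_space p s \<Omega> = {u \<in> borel_measurable borel. (\<forall>x. x \<notin> \<Omega> \<longrightarrow> u x = 0) \<and>
     (\<exists>\<phi>. (\<forall>n. \<phi> n \<in> test_functions \<Omega>) \<and>
          (\<lambda>n::nat. W_norm_p p s (\<lambda>x. \<phi> n x - u x)) \<longlonglongrightarrow> 0)}"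


section \<open>The fractional p-Laplacian and its semigroup\<close>

definition frac_p_form ::
    "real \<Rightarrow> real \<Rightarrow> ('a::euclidean_space \<Rightarrow> real) \<Rightarrow> ('a \<Rightarrow> real) \<Rightarrow> real" where
  "frac_p_form p s u \<phi> =
     (LINT (x, y)|(lborel \<Otimes>\<^sub>M lborel).
        \<bar>u x - u y\<bar> powr (p - 2) * (u x - u y) * (\<phi> x - \<phi> y)
          / norm (x - y) powr (real DIM('a) + s * p))"

text \<open>\<open>frac_p_Laplacian p s \<Omega> u w\<close> is the relation \<open>\<L>u = w \<in> L\<^sup>2(\<Omega>)\<close>.\<close>

definition frac_p_Laplacian ::
    "real \<Rightarrow> real \<Rightarrow> 'a::euclidean_space set \<Rightarrow> ('a \<Rightarrow> real) \<Rightarrow> ('a \<Rightarrow> real) \<Rightarrow> bool" where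
  "frac_p_Laplacian p s \<Omega> u w \<longleftrightarrow> u \<in> W0_space p s \<Omega> \<and> w \<in> Lr_space 2 \<Omega> \<and>
     (\<forall>\<phi>\<in>W0_space p s \<Omega>. frac_p_form p s u \<phi> = (LINT x:\<Omega>|lborel. w x * \<phi> x))"

text \<open>Absolute continuity, with respect to the \<open>L\<^sup>2\<close> norm, of a curve on \<open>{\<alpha>..\<beta>}\<close>; the intervals
  \<open>{a i..b i}\<close> are non-overlapping and listed in increasing order.\<close>

definition L2_absolutely_continuous ::
    "real \<Rightarrow> real \<Rightarrow> (real \<Rightarrow> 'a::euclidean_space \<Rightarrow> real) \<Rightarrow> bool" where
  "L2_absolutely_continuous \<alpha> \<beta> u \<longleftrightarrow>
     (\<forall>\<epsilon>>0. \<exists>\<delta>>0. \<forall>(n::nat) a b.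
        (\<forall>i<n. \<alpha> \<le> a i \<and> a i \<le> b i \<and> b i \<le> \<beta>) \<and> (\<forall>j<n. \<forall>i<j. b i \<le> a j) \<and>
        (\<Sum>i<n. b i - a i) < \<delta> \<longrightarrow>
        (\<Sum>i<n. L2_norm (\<lambda>x. u (b i) x - u (a i) x)) < \<epsilon>)"

definition has_L2_time_derivative ::
    "(real \<Rightarrow> 'a::euclidean_space \<Rightarrow> real) \<Rightarrow> ('a \<Rightarrow> real) \<Rightarrow> real \<Rightarrow> bool" where
  "has_L2_time_derivative u v t \<longleftrightarrow>
     ((\<lambda>h. L2_norm (\<lambda>x. (u (t + h) x - u t x) / h - v x)) \<longlongrightarrow> 0) (at 0)"

text \<open>The equation \<open>du/dt = -\<L>u\<close> for \<open>t > 0\<close> in the strong sense. Local absolute continuity on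
  \<open>(0,\<infinity>)\<close> is part of the notion of a strong solution: an equation holding only for almost every
  \<open>t\<close> would otherwise not determine the curve.\<close>

definition solves_equation ::
    "real \<Rightarrow> real \<Rightarrow> 'a::euclidean_space set \<Rightarrow> (real \<Rightarrow> 'a \<Rightarrow> real) \<Rightarrow> bool" where
  "solves_equation p s \<Omega> u \<longleftrightarrow>
     (\<forall>t>0. u t \<in> Lr_space 2 \<Omega>) \<and>
     (\<forall>\<alpha> \<beta>. 0 < \<alpha> \<and> \<alpha> < \<beta> \<longrightarrow> L2_absolutely_continuous \<alpha> \<beta> u) \<and>
     (\<exists>w. (\<forall>t>0. frac_p_Laplacian p s \<Omega> (u t) (w t)) \<and>
          (AE t in lborel. t > 0 \<longrightarrow> has_L2_time_derivative u (\<lambda>x. - w t x) t))"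

definition strong_solution ::
    "real \<Rightarrow> real \<Rightarrow> 'a::euclidean_space set \<Rightarrow> ('a \<Rightarrow> real) \<Rightarrow> (real \<Rightarrow> 'a \<Rightarrow> real) \<Rightarrow> bool" where
  "strong_solution p s \<Omega> u0 u \<longleftrightarrow>
     u0 \<in> Lr_space 2 \<Omega> \<and> (\<forall>t\<ge>0. u t \<in> Lr_space 2 \<Omega>) \<and>
     (AE x in lborel. u 0 x = u0 x) \<and>
     (\<forall>t\<ge>0. ((\<lambda>t'. L2_norm (\<lambda>x. u t' x - u t x)) \<longlongrightarrow> 0) (at t within {0..})) \<and>
     solves_equation p s \<Omega> u"

text \<open>The solution for integrable data: the extension of the semigroup from \<open>L\<^sup>2(\<Omega>)\<close> to
  \<open>L\<^sup>1(\<Omega>)\<close> by continuity, i.e. the \<open>L\<^sup>1\<close> limit at each time of strong solutions whose initial data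
  converge to \<open>u0\<close>. Constant sequences show that strong solutions are included (\<open>\<Omega>\<close> bounded).\<close>

definition semigroup_solution ::
    "real \<Rightarrow> real \<Rightarrow> 'a::euclidean_space set \<Rightarrow> ('a \<Rightarrow> real) \<Rightarrow> (real \<Rightarrow> 'a \<Rightarrow> real) \<Rightarrow> bool" where
  "semigroup_solution p s \<Omega> u0 u \<longleftrightarrow>
     u0 \<in> Lr_space 1 \<Omega> \<and> (\<forall>t\<ge>0. u t \<in> Lr_space 1 \<Omega>) \<and>
     (\<exists>v0 v. (\<forall>n::nat. strong_solution p s \<Omega> (v0 n) (v n)) \<and>
        (\<lambda>n. L1_norm (\<lambda>x. v0 n x - u0 x)) \<longlonglongrightarrow> 0 \<and>
        (\<forall>t\<ge>0. (\<lambda>n. L1_norm (\<lambda>x. v n t x - u t x)) \<longlonglongrightarrow> 0))"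

definition separable_solution ::
    "real \<Rightarrow> ('a::euclidean_space \<Rightarrow> real) \<Rightarrow> real \<Rightarrow> 'a \<Rightarrow> real" where
  "separable_solution p F t x = t powr (- 1 / (p - 2)) * F x"

end

theory Submission
  imports Defs
begin

text \<open>For two strong solutions the form of the fractional \<open>p\<close>-Laplacian is monotone when tested with
  the positive part of the difference, so \<open>\<integral> (u - v)\<^sub>+\<^sup>2\<close> has nonpositive derivative for almost every
  \<open>t\<close>; being absolutely continuous, it is nonincreasing. Compare a strong solution \<open>v\<close> with the
  time shift \<open>U(t + e) \<le> U(t)\<close>: the integral of \<open>(v(t) - U(t))\<^sub>+\<^sup>2\<close> is at most that of
  \<open>(v(0) - e powr (-1/(p-2)) F)\<^sub>+\<^sup>2\<close>, which tends to 0 as \<open>e\<close> does, since \<open>F > 0\<close> on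
  \<open>\<Omega>\<close>. Limits in \<open>L\<^sup>1\<close> of strong solutions inherit the bound.\<close>

section \<open>Square-integrable functions\<close>

text \<open>U blows up as t tends to 0, so it has no initial datum in L2 and cannot itself enter a
  comparison from time 0; the shift by e > 0 repairs this. Even then no single e need place the
  initial datum below \<open>e powr (-1/(p-2)) * F\<close>: the datum may be unbounded and nothing
  bounds F below on \<Omega>. Preservation of order would therefore be too weak. The contraction has
  to be quantitative, bounding the excess at time t by an initial excess that vanishes only in the
  limit.

  Two obstacles shape the rest. The positive part of a difference must be an admissible test
  function, yet the Sobolev space is a closure of smooth functions and \<open>max\<close> is not
  smooth; hence the smooth truncations and the convergence results for energies. And the equation
  holds only for almost every t, where the squared norm of the positive part is controlled from
  above through its difference quotients; hence a monotonicity theorem for absolutely continuous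
  real functions under an almost-everywhere upper bound of that kind.\<close>

definition square_integrable :: "('a::euclidean_space \<Rightarrow> real) set" where
  "square_integrable = {f \<in> borel_measurable borel. integrable lborel (\<lambda>x. (f x)\<^sup>2)}"

lemma square_integrable_borel[measurable_dest]:
  "f \<in> square_integrable \<Longrightarrow> f \<in> borel_measurable borel"
  by (simp add: square_integrable_def)

lemma square_integrable_sq: "f \<in> square_integrable \<Longrightarrow> integrable lborel (\<lambda>x. (f x)\<^sup>2)"
  by (simp add: square_integrable_def)

lemma square_integrable_dominated:
  assumes "f \<in> square_integrable" "g \<in> borel_measurable borel" "\<And>x. \<bar>g x\<bar> \<le> \<bar>f x\<bar>"
  shows "g \<in> square_integrable"
proof -
  have "integrable lborel (\<lambda>x. (g x)\<^sup>2)"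
    by (rule Bochner_Integration.integrable_bound[OF square_integrable_sq[OF assms(1)]])
      (use assms in \<open>auto simp: abs_le_square_iff\<close>)
  then show ?thesis using assms by (simp add: square_integrable_def)
qed

lemma square_integrable_mult:
  assumes "f \<in> square_integrable" "g \<in> square_integrable"
  shows "integrable lborel (\<lambda>x. f x * g x)"
proof (rule Bochner_Integration.integrable_bound)
  show "integrable lborel (\<lambda>x. (f x)\<^sup>2 + (g x)\<^sup>2)"
    using assms by (intro Bochner_Integration.integrable_add square_integrable_sq)
  have "\<bar>a * b\<bar> \<le> a\<^sup>2 + b\<^sup>2" for a b :: real
  proof -
    have "0 \<le> \<bar>a\<bar> * \<bar>b\<bar>" "2 * \<bar>a\<bar> * \<bar>b\<bar> \<le> a\<^sup>2 + b\<^sup>2"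
      using sum_squares_bound[of "\<bar>a\<bar>" "\<bar>b\<bar>"] by auto
    then show ?thesis unfolding abs_mult by linarith
  qed
  then show "AE x in lborel. norm (f x * g x) \<le> norm ((f x)\<^sup>2 + (g x)\<^sup>2)"
    by simp
qed (use assms in \<open>auto simp: square_integrable_def\<close>)

lemma square_integrable_add:
  assumes "f \<in> square_integrable" "g \<in> square_integrable"
  shows "(\<lambda>x. f x + g x) \<in> square_integrable"
proof -
  have "integrable lborel (\<lambda>x. (f x)\<^sup>2 + (g x)\<^sup>2 + 2 * (f x * g x))"
    using assms by (intro Bochner_Integration.integrable_add square_integrable_sq
        integrable_mult_right square_integrable_mult)
  then show ?thesis
    using assms by (auto simp: square_integrable_def power2_sum algebra_simps intro: borel_measurable_add)
qed

lemma square_integrable_cmult: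
  "f \<in> square_integrable \<Longrightarrow> (\<lambda>x. c * f x) \<in> square_integrable"
  by (auto simp: square_integrable_def power_mult_distrib)

lemma square_integrable_diff:
  assumes "f \<in> square_integrable" "g \<in> square_integrable"
  shows "(\<lambda>x. f x - g x) \<in> square_integrable"
  using square_integrable_add[OF assms(1) square_integrable_cmult[OF assms(2), of "-1"]] by simp

lemma square_integrable_divide:
  "f \<in> square_integrable \<Longrightarrow> (\<lambda>x. f x / c) \<in> square_integrable"
  using square_integrable_cmult[of f "1 / c"] by simp

lemma square_integrable_pos_part:
  "f \<in> square_integrable \<Longrightarrow> (\<lambda>x. max 0 (f x)) \<in> square_integrable"
  by (rule square_integrable_dominated) (auto simp: square_integrable_def)

lemmas square_integrable_intros =
  square_integrable_add square_integrable_cmult square_integrable_diff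
  square_integrable_divide square_integrable_pos_part

section \<open>The L2 seminorm and its behaviour under positive parts\<close>

lemma L2_norm_nonneg: "0 \<le> L2_norm f"
  by (simp add: L2_norm_def)

lemma L2_norm_power2: "(L2_norm f)\<^sup>2 = (LINT x|lborel. (f x)\<^sup>2)"
  by (simp add: L2_norm_def)

lemma L2_norm_cmult: "L2_norm (\<lambda>x. c * f x) = \<bar>c\<bar> * L2_norm f"
  by (simp add: L2_norm_def power_mult_distrib real_sqrt_mult)

lemma L2_norm_minus: "L2_norm (\<lambda>x. - f x) = L2_norm f"
  by (simp add: L2_norm_def)

text \<open>Square integrability of \<open>f\<close> matters: the Bochner integral of a
  non-integrable function is 0, so a larger function could otherwise have a smaller
  \<open>L2_norm\<close>.\<close>

lemma L2_norm_mono: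
  assumes "f \<in> square_integrable" "g \<in> borel_measurable borel" "\<And>x. \<bar>g x\<bar> \<le> \<bar>f x\<bar>"
  shows "L2_norm g \<le> L2_norm f"
  unfolding L2_norm_def
  using square_integrable_dominated[OF assms] assms
  by (intro real_sqrt_le_mono integral_mono square_integrable_sq) (auto simp: abs_le_square_iff)

lemma integral_square_add_cmult:
  assumes "f \<in> square_integrable" "g \<in> square_integrable"
  shows "(LINT x|lborel. (f x + c * g x)\<^sup>2) =
    (LINT x|lborel. (f x)\<^sup>2) + 2 * c * (LINT x|lborel. f x * g x) + c\<^sup>2 * (LINT x|lborel. (g x)\<^sup>2)"
proof -
  have "(f x + c * g x)\<^sup>2 = (f x)\<^sup>2 + 2 * c * (f x * g x) + c\<^sup>2 * (g x)\<^sup>2" for x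
    by (simp add: power2_sum power_mult_distrib)
  then show ?thesis
    using square_integrable_sq[OF assms(1)] square_integrable_sq[OF assms(2)] square_integrable_mult[OF assms]
    by simp
qed

text \<open>Discriminant argument: the integral of \<open>(f + c g)\<^sup>2\<close> is a quadratic
  in c that is never negative.\<close>

lemma L2_norm_Cauchy_Schwarz:
  assumes "f \<in> square_integrable" "g \<in> square_integrable"
  shows "\<bar>LINT x|lborel. f x * g x\<bar> \<le> L2_norm f * L2_norm g"
proof -
  define A where "A = (LINT x|lborel. (f x)\<^sup>2)"
  define B where "B = (LINT x|lborel. (g x)\<^sup>2)"
  define C where "C = (LINT x|lborel. f x * g x)"
  have quadratic: "0 \<le> A + 2 * c * C + c\<^sup>2 * B" for c
  proof -
    have "0 \<le> (LINT x|lborel. (f x + c * g x)\<^sup>2)"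
      by simp
    also have "\<dots> = A + 2 * c * C + c\<^sup>2 * B"
      unfolding A_def B_def C_def by (rule integral_square_add_cmult[OF assms])
    finally show ?thesis .
  qed
  have "A \<ge> 0" "B \<ge> 0"
    by (auto simp: A_def B_def)
  have "C\<^sup>2 \<le> A * B"
  proof (cases "B = 0")
    case True
    have "C = 0"
    proof (rule ccontr)
      assume "C \<noteq> 0"
      \<comment> \<open>With B = 0 the quadratic is affine in c, and this c would give it the value
        -1.\<close>
      then have "2 * (- (A + 1) / (2 * C)) * C = - (A + 1)" by simp
      with quadratic[of "- (A + 1) / (2 * C)"] True show False by simp
    qed
    then show ?thesis using True by simp
  next
    case False
    then have "B > 0" using \<open>B \<ge> 0\<close> by simp
    \<comment> \<open>The minimiser -C/B of the quadratic; the factor B clears the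
      denominator.\<close>
    have "0 \<le> (A + 2 * (- C / B) * C + (- C / B)\<^sup>2 * B) * B"
      using quadratic[of "- C / B"] \<open>B \<ge> 0\<close> by (rule mult_nonneg_nonneg)
    also have "\<dots> = A * B - C\<^sup>2"
      using False by (simp add: field_simps power2_eq_square)
    finally show ?thesis by simp
  qed
  then have "sqrt (C\<^sup>2) \<le> sqrt (A * B)"
    by (rule real_sqrt_le_mono)
  then show ?thesis
    by (simp add: L2_norm_def A_def B_def C_def real_sqrt_mult)
qed

lemma L2_norm_triangle:
  assumes "f \<in> square_integrable" "g \<in> square_integrable"
  shows "L2_norm (\<lambda>x. f x + g x) \<le> L2_norm f + L2_norm g"
proof (rule power2_le_imp_le)
  have "(L2_norm (\<lambda>x. f x + g x))\<^sup>2 = (L2_norm f)\<^sup>2 + 2 * (LINT x|lborel. f x * g x) + (L2_norm g)\<^sup>2"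
    using integral_square_add_cmult[OF assms, of 1] by (simp add: L2_norm_power2)
  also have "\<dots> \<le> (L2_norm f + L2_norm g)\<^sup>2"
    using L2_norm_Cauchy_Schwarz[OF assms] by (simp add: power2_sum)
  finally show "(L2_norm (\<lambda>x. f x + g x))\<^sup>2 \<le> (L2_norm f + L2_norm g)\<^sup>2" .
qed (simp add: L2_norm_nonneg)

lemma L2_norm_triangle_diff:
  assumes "f \<in> square_integrable" "g \<in> square_integrable"
  shows "L2_norm (\<lambda>x. f x - g x) \<le> L2_norm f + L2_norm g"
  using L2_norm_triangle[OF assms(1) square_integrable_cmult[OF assms(2), of "-1"]]
  by (simp add: L2_norm_minus)

text \<open>Holds because \<open>max 0\<close> is 1-Lipschitz pointwise. It transfers continuity and
  absolute continuity from a curve in L2 to the norm of its positive part.\<close>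

lemma L2_norm_pos_part_diff:
  assumes "f \<in> square_integrable" "g \<in> square_integrable"
  shows "\<bar>L2_norm (\<lambda>x. max 0 (f x)) - L2_norm (\<lambda>x. max 0 (g x))\<bar> \<le> L2_norm (\<lambda>x. f x - g x)"
proof -
  have *: "L2_norm (\<lambda>x. max 0 (f x)) \<le> L2_norm (\<lambda>x. max 0 (g x)) + L2_norm (\<lambda>x. f x - g x)"
    if "f \<in> square_integrable" "g \<in> square_integrable" for f g :: "'a \<Rightarrow> real"
  proof -
    have [measurable]: "f \<in> borel_measurable borel" "g \<in> borel_measurable borel"
      using that by (auto simp: square_integrable_borel)
    have "L2_norm (\<lambda>x. max 0 (f x)) = L2_norm (\<lambda>x. max 0 (g x) + (max 0 (f x) - max 0 (g x)))"
      by simp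
    also have "\<dots> \<le> L2_norm (\<lambda>x. max 0 (g x)) + L2_norm (\<lambda>x. max 0 (f x) - max 0 (g x))"
      using that by (intro L2_norm_triangle square_integrable_intros)
    also have "L2_norm (\<lambda>x. max 0 (f x) - max 0 (g x)) \<le> L2_norm (\<lambda>x. f x - g x)"
      using that by (intro L2_norm_mono square_integrable_intros) (auto simp: max_def)
    finally show ?thesis by simp
  qed
  have "L2_norm (\<lambda>x. g x - f x) = L2_norm (\<lambda>x. f x - g x)"
    using L2_norm_minus[of "\<lambda>x. f x - g x"] by simp
  with *[of f g] *[of g f] assms show ?thesis by simp
qed

lemma Lr_space_2_iff:
  "f \<in> Lr_space 2 \<Omega> \<longleftrightarrow> f \<in> square_integrable \<and> (\<forall>x. x \<notin> \<Omega> \<longrightarrow> f x = 0)"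
proof -
  have "\<bar>a\<bar> powr real_of_ereal 2 = a\<^sup>2" for a :: real
    by (simp add: powr_numeral)
  then show ?thesis
    by (auto simp: Lr_space_def square_integrable_def)
qed

section \<open>Absolutely continuous functions with nonpositive derivative\<close>

text \<open>Serves to concatenate two finite lists of intervals, the second one reindexed by
  n.\<close>

lemma sum_lessThan_add:
  fixes f g :: "nat \<Rightarrow> real"
  shows "(\<Sum>i<n + m. if i < n then f i else g (i - n)) = (\<Sum>i<n. f i) + (\<Sum>i<m. g i)"
  by (induction m) auto

text \<open>Bisection: \<open>f\<close> increases on \<open>{a..b}\<close> by at most \<open>\<epsilon> * (b - a)\<close> plus its variation over finitely
  many intervals inside an open set \<open>G\<close> of small measure that contains the exceptional null set.\<close>

lemma absolutely_continuous_nonincreasing: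
  fixes f :: "real \<Rightarrow> real"
  assumes "\<alpha> \<le> \<beta>"
    and ac: "\<And>\<epsilon>. 0 < \<epsilon> \<Longrightarrow> \<exists>\<delta>>0. \<forall>(n::nat) a b.
        (\<forall>i<n. \<alpha> \<le> a i \<and> a i \<le> b i \<and> b i \<le> \<beta>) \<and> (\<forall>j<n. \<forall>i<j. b i \<le> a j) \<and>
        (\<Sum>i<n. b i - a i) < \<delta> \<longrightarrow> (\<Sum>i<n. \<bar>f (b i) - f (a i)\<bar>) < \<epsilon>"
    and deriv: "AE t in lborel. t \<in> {\<alpha>..\<beta>} \<longrightarrow>
        (\<forall>\<eta>>0. \<forall>\<^sub>F h in at 0. (f (t + h) - f t) / h \<le> \<eta>)"
  shows "f \<beta> \<le> f \<alpha>"
proof -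
  have bound: "f \<beta> - f \<alpha> \<le> \<epsilon> * (\<beta> - \<alpha>) + \<epsilon>" if eps: "\<epsilon> > 0" for \<epsilon> :: real
  proof -
    obtain \<delta> :: real where "\<delta> > 0" and \<delta>: "\<forall>(n::nat) a b.
        (\<forall>i<n. \<alpha> \<le> a i \<and> a i \<le> b i \<and> b i \<le> \<beta>) \<and> (\<forall>j<n. \<forall>i<j. b i \<le> a j) \<and>
        (\<Sum>i<n. b i - a i) < \<delta> \<longrightarrow> (\<Sum>i<n. \<bar>f (b i) - f (a i)\<bar>) < \<epsilon>"
      using ac[OF eps] by blast
    obtain N where N: "N \<in> null_sets lborel" and good: "\<And>t. t \<in> space lborel - N \<Longrightarrow> t \<in> {\<alpha>..\<beta>} \<longrightarrow>
        (\<forall>\<eta>>0. \<forall>\<^sub>F h in at 0. (f (t + h) - f t) / h \<le> \<eta>)"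
      using AE_E3[OF deriv] by blast
    have "N \<in> sets borel" using N by (auto simp: null_sets_def)
    \<comment> \<open>As N is null, G itself has measure below \<delta>. Disjoint intervals charged
      against the measure of G will thus fall under absolute continuity.\<close>
    obtain G where G: "open G" "N \<subseteq> G" "emeasure lborel (G - N) < ennreal \<delta>"
      using outer_regular_lborel[OF \<open>N \<in> sets borel\<close> \<open>\<delta> > 0\<close>] by blast
    have [measurable]: "G \<in> sets borel" using G by simp
    have measG: "emeasure lborel G < ennreal \<delta>"
      using G(3) N emeasure_Diff_null_set[of N lborel G] by simp
    then have finG: "emeasure lborel G < \<infinity>"
      by (metis ennreal_less_top infinity_ennreal_def order.strict_trans)
    have fin: "emeasure lborel (G \<inter> A) \<noteq> \<infinity>" if "A \<in> sets borel" for A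
    proof -
      have "emeasure lborel (G \<inter> A) \<le> emeasure lborel G"
        using that by (intro emeasure_mono) auto
      then show ?thesis using finG by (auto simp: top_unique)
    qed
    \<comment> \<open>Half-open intervals make \<open>m\<close> exactly additive when an interval is
      split.\<close>
    define m where "m a b = measure lborel (G \<inter> {a..<b})" for a b
    have m_add: "m a e = m a b + m b e" if "a \<le> b" "b \<le> e" for a b e
    proof -
      have "G \<inter> {a..<e} = (G \<inter> {a..<b}) \<union> (G \<inter> {b..<e})"
        using that by auto
      then show ?thesis
        unfolding m_def using fin by (subst measure_Union[symmetric]) auto
    qed
    \<comment> \<open>The guard is there because the local case of Bolzano's principle ranges over
      all short intervals around a point, including those that leave [\<alpha>, \<beta>]. The
      intervals are kept in increasing order since absolute continuity is stated for such lists
      only.\<close>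
    define P where "P a b \<longleftrightarrow> (\<alpha> \<le> a \<and> b \<le> \<beta> \<longrightarrow> (\<exists>(n::nat) c d.
        (\<forall>i<n. a \<le> c i \<and> c i \<le> d i \<and> d i \<le> b) \<and> (\<forall>j<n. \<forall>i<j. d i \<le> c j) \<and>
        (\<Sum>i<n. d i - c i) \<le> m a b \<and>
        f b - f a \<le> \<epsilon> * (b - a) + (\<Sum>i<n. \<bar>f (d i) - f (c i)\<bar>)))" for a b
    have "P \<alpha> \<beta>"
      using assms(1)
    proof (induction rule: Bolzano)
      case (trans a b e)
      show ?case
        unfolding P_def
      proof
        assume ae: "\<alpha> \<le> a \<and> e \<le> \<beta>"
        have ab: "\<alpha> \<le> a \<and> b \<le> \<beta>" and be: "\<alpha> \<le> b \<and> e \<le> \<beta>"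
          using ae trans(3,4) by auto
        obtain n :: nat and c d where 1: "\<forall>i<n. a \<le> c i \<and> c i \<le> d i \<and> d i \<le> b" "\<forall>j<n. \<forall>i<j. d i \<le> c j"
          "(\<Sum>i<n. d i - c i) \<le> m a b"
          "f b - f a \<le> \<epsilon> * (b - a) + (\<Sum>i<n. \<bar>f (d i) - f (c i)\<bar>)"
          using mp[OF trans(1)[unfolded P_def] ab] by blast
        obtain n' :: nat and c' d' where 2: "\<forall>i<n'. b \<le> c' i \<and> c' i \<le> d' i \<and> d' i \<le> e" "\<forall>j<n'. \<forall>i<j. d' i \<le> c' j"
          "(\<Sum>i<n'. d' i - c' i) \<le> m b e"
          "f e - f b \<le> \<epsilon> * (e - b) + (\<Sum>i<n'. \<bar>f (d' i) - f (c' i)\<bar>)"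
          using mp[OF trans(2)[unfolded P_def] be] by blast
        \<comment> \<open>Concatenation keeps the order: the first list ends at b or earlier, the
          second starts at b or later.\<close>
        define c'' where "c'' i = (if i < n then c i else c' (i - n))" for i
        define d'' where "d'' i = (if i < n then d i else d' (i - n))" for i
        have *: "(\<Sum>i<n + n'. h (d'' i) (c'' i)) = (\<Sum>i<n. h (d i) (c i)) + (\<Sum>i<n'. h (d' i) (c' i))"
          for h :: "real \<Rightarrow> real \<Rightarrow> real"
          by (subst sum_lessThan_add[symmetric]) (auto intro!: sum.cong simp: c''_def d''_def)
        have "a \<le> c'' i \<and> c'' i \<le> d'' i \<and> d'' i \<le> e" if "i < n + n'" for i
        proof (cases "i < n")
          case True
          then show ?thesis using 1(1) trans(3,4) by (force simp: c''_def d''_def)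
        next
          case False
          then have "i - n < n'" using that by simp
          then show ?thesis using False 2(1) trans(3,4) by (force simp: c''_def d''_def)
        qed
        moreover have "d'' i \<le> c'' j" if "j < n + n'" "i < j" for i j
        proof (cases "j < n")
          case True
          then show ?thesis using 1(2) that by (simp add: c''_def d''_def)
        next
          case False
          then have j: "j - n < n'" using that by simp
          show ?thesis
          proof (cases "i < n")
            case True
            then show ?thesis
              using False 1(1) 2(1) j by (force simp: c''_def d''_def)
          next
            case i: False
            then have "i - n < j - n" using that by simp
            then show ?thesis using False i 2(2) j by (simp add: c''_def d''_def)
          qed
        qed
        moreover have "(\<Sum>i<n + n'. d'' i - c'' i) \<le> m a e"
          using *[of "\<lambda>x y. x - y"] 1(3) 2(3) m_add[OF trans(3,4)] by simp
        moreover have "f e - f a \<le> \<epsilon> * (e - a) + (\<Sum>i<n + n'. \<bar>f (d'' i) - f (c'' i)\<bar>)"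
          using *[of "\<lambda>x y. \<bar>f x - f y\<bar>"] 1(4) 2(4) by (simp add: algebra_simps)
        ultimately show "\<exists>(n::nat) c d. (\<forall>i<n. a \<le> c i \<and> c i \<le> d i \<and> d i \<le> e) \<and> (\<forall>j<n. \<forall>i<j. d i \<le> c j) \<and>
           (\<Sum>i<n. d i - c i) \<le> m a e \<and>
           f e - f a \<le> \<epsilon> * (e - a) + (\<Sum>i<n. \<bar>f (d i) - f (c i)\<bar>)"
          by - (rule exI[of _ "n + n'"], rule exI[of _ c''], rule exI[of _ d''], simp)
      qed
    next
      case (local x)
      show ?case
      proof (cases "x \<in> N")
        case True
        then obtain r where r: "r > 0" "ball x r \<subseteq> G"
          using G by (meson open_contains_ball subsetD)
        \<comment> \<open>A whole neighbourhood of an exceptional point lies in G, so the interval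
          from a to b can itself be charged: its length equals \<open>m a b\<close>.\<close>
        have "P a b" if ab: "a \<le> x \<and> x \<le> b \<and> b - a < r" for a b
        proof -
          have "{a..<b} \<subseteq> ball x r"
            using ab by (auto simp: dist_real_def)
          then have "G \<inter> {a..<b} = {a..<b}"
            using r by auto
          then have "m a b = b - a"
            using ab by (simp add: m_def)
          moreover have "f b - f a \<le> \<epsilon> * (b - a) + \<bar>f b - f a\<bar>"
          proof -
            have "0 \<le> \<epsilon> * (b - a)"
              using ab \<open>\<epsilon> > 0\<close> by simp
            then show ?thesis by linarith
          qed
          ultimately show ?thesis
            unfolding P_def using ab \<open>\<epsilon> > 0\<close>
            by - (rule impI, rule exI[of _ "1::nat"], rule exI[of _ "\<lambda>_. a"], rule exI[of _ "\<lambda>_. b"], auto)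
        qed
        then show ?thesis using r by blast
      next
        case False
        then have "\<forall>\<^sub>F h in at 0. (f (x + h) - f x) / h \<le> \<epsilon>"
          using good[of x] local \<open>\<epsilon> > 0\<close> by auto
        then obtain r where r: "r > 0" "\<And>h. h \<noteq> 0 \<Longrightarrow> \<bar>h\<bar> < r \<Longrightarrow> (f (x + h) - f x) / h \<le> \<epsilon>"
          unfolding eventually_at by (auto simp: dist_real_def)
        \<comment> \<open>At a good point nothing is charged. The quotient bound holds for h of both
          signs, so it applies from x forward to b and back to a.\<close>
        have "P a b" if ab: "a \<le> x \<and> x \<le> b \<and> b - a < r" for a b
        proof -
          have "f b - f x \<le> \<epsilon> * (b - x)"
            using r(2)[of "b - x"] ab by (cases "b = x") (auto simp: field_simps)
          moreover have "f x - f a \<le> \<epsilon> * (x - a)"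
            using r(2)[of "a - x"] ab by (cases "a = x") (auto simp: field_simps)
          ultimately have "f b - f a \<le> \<epsilon> * (b - a)"
            by (simp add: algebra_simps)
          then show ?thesis
            unfolding P_def by (intro impI exI[of _ "0::nat"]) (auto simp: m_def)
        qed
        then show ?thesis using r by blast
      qed
    qed
    obtain n :: nat and c d where 1: "\<forall>i<n. \<alpha> \<le> c i \<and> c i \<le> d i \<and> d i \<le> \<beta>" "\<forall>j<n. \<forall>i<j. d i \<le> c j"
        "(\<Sum>i<n. d i - c i) \<le> m \<alpha> \<beta>"
        "f \<beta> - f \<alpha> \<le> \<epsilon> * (\<beta> - \<alpha>) + (\<Sum>i<n. \<bar>f (d i) - f (c i)\<bar>)"
      using mp[OF \<open>P \<alpha> \<beta>\<close>[unfolded P_def]] by blast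
    \<comment> \<open>The charged intervals have total length at most the measure of G, hence below
      \<delta>.\<close>
    have "ennreal (m \<alpha> \<beta>) = emeasure lborel (G \<inter> {\<alpha>..<\<beta>})"
      using fin[of "{\<alpha>..<\<beta>}"] by (simp add: m_def emeasure_eq_ennreal_measure)
    also have "\<dots> \<le> emeasure lborel G"
      by (intro emeasure_mono) auto
    also note measG
    finally have "m \<alpha> \<beta> < \<delta>"
      by (simp add: ennreal_less_iff m_def)
    then have "(\<Sum>i<n. d i - c i) < \<delta>" using 1(3) by simp
    with 1 have "(\<Sum>i<n. \<bar>f (d i) - f (c i)\<bar>) < \<epsilon>"
      using \<delta>[THEN spec[of _ n], THEN spec[of _ c], THEN spec[of _ d]] by simp
    then show ?thesis using 1(4) by simp
  qed
  show ?thesis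
  proof (rule field_le_epsilon)
    fix e :: real assume "e > 0"
    \<comment> \<open>Makes the slope term and the variation term add up to exactly e. The summand 1
      is the share of the variation term and keeps the denominator positive when \<alpha> =
      \<beta>.\<close>
    define \<epsilon> where "\<epsilon> = e / (\<beta> - \<alpha> + 1)"
    have "\<epsilon> > 0" using \<open>e > 0\<close> assms(1) by (simp add: \<epsilon>_def)
    have "\<epsilon> * (\<beta> - \<alpha>) + \<epsilon> = \<epsilon> * (\<beta> - \<alpha> + 1)" by (simp add: algebra_simps)
    also have "\<dots> = e" using assms(1) by (simp add: \<epsilon>_def)
    finally show "f \<beta> \<le> f \<alpha> + e" using bound[OF \<open>\<epsilon> > 0\<close>] by simp
  qed
qed

section \<open>Decay of the positive part along curves in \<open>L\<^sup>2\<close>\<close>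

text \<open>The function \<open>(max 0 x)\<^sup>2\<close> is convex with the 2-Lipschitz derivative
  \<open>2 * max 0 x\<close>. Convexity is the lower bound; the Lipschitz constant gives the
  quadratic error in the upper one.\<close>

lemma pos_part_square_increment:
  fixes x y :: real
  shows "2 * (max 0 x * y) \<le> (max 0 (x + y))\<^sup>2 - (max 0 x)\<^sup>2"
    and "(max 0 (x + y))\<^sup>2 - (max 0 x)\<^sup>2 \<le> 2 * (max 0 x * y) + y\<^sup>2"
proof -
  have "2 * (max 0 x * y) \<le> (max 0 (x + y))\<^sup>2 - (max 0 x)\<^sup>2 \<and>
    (max 0 (x + y))\<^sup>2 - (max 0 x)\<^sup>2 \<le> 2 * (max 0 x * y) + y\<^sup>2"
  proof (cases "x \<ge> 0")
    case True
    show ?thesis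
    proof (cases "x + y \<ge> 0")
      case False
      have "x * (x + 2 * y) \<le> 0"
        using True False by (intro mult_nonneg_nonpos) auto
      moreover have "0 \<le> (x + y)\<^sup>2" by simp
      ultimately show ?thesis
        using True False by (simp add: power2_eq_square algebra_simps)
    qed (use True in \<open>simp add: power2_eq_square algebra_simps\<close>)
  next
    case False
    then have "(max 0 (x + y))\<^sup>2 \<le> y\<^sup>2"
      by (intro abs_le_square_iff[THEN iffD1]) (auto simp: max_def)
    then show ?thesis using False by (simp add: max_def)
  qed
  then show "2 * (max 0 x * y) \<le> (max 0 (x + y))\<^sup>2 - (max 0 x)\<^sup>2"
    and "(max 0 (x + y))\<^sup>2 - (max 0 x)\<^sup>2 \<le> 2 * (max 0 x * y) + y\<^sup>2"
    by auto
qed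

text \<open>The leading term is the formal derivative of the squared norm in direction D. The
  bracket is the cost of replacing the true difference quotient by D and vanishes together with h
  and r.\<close>

lemma pos_part_difference_quotient:
  fixes X Z D :: "'a::euclidean_space \<Rightarrow> real"
  assumes X: "X \<in> square_integrable" and Z: "Z \<in> square_integrable" and D: "D \<in> square_integrable"
    and "h \<noteq> 0"
  defines "P \<equiv> \<lambda>x. max 0 (X x)"
  defines "r \<equiv> L2_norm (\<lambda>x. (Z x - X x) / h - D x)"
  shows "((L2_norm (\<lambda>x. max 0 (Z x)))\<^sup>2 - (L2_norm P)\<^sup>2) / h \<le>
    2 * (LINT x|lborel. P x * D x) + (2 * L2_norm P * r + \<bar>h\<bar> * (L2_norm D + r)\<^sup>2)"
proof -
  define q where "q x = (Z x - X x) / h" for x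
  have q: "q \<in> square_integrable"
    unfolding q_def using X Z by (intro square_integrable_intros)
  have P: "P \<in> square_integrable" and ZP: "(\<lambda>x. max 0 (Z x)) \<in> square_integrable"
    unfolding P_def using X Z by (auto intro: square_integrable_intros)
  have Zq: "Z x = X x + h * q x" for x
    using \<open>h \<noteq> 0\<close> by (simp add: q_def)
  define \<Delta> where "\<Delta> = (L2_norm (\<lambda>x. max 0 (Z x)))\<^sup>2 - (L2_norm P)\<^sup>2"
  define I where "I = (LINT x|lborel. P x * q x)"
  have \<Delta>: "\<Delta> = (LINT x|lborel. (max 0 (Z x))\<^sup>2 - (P x)\<^sup>2)"
    unfolding \<Delta>_def L2_norm_power2
    by (rule Bochner_Integration.integral_diff[symmetric]; rule square_integrable_sq[OF ZP] square_integrable_sq[OF P])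
  have int\<Delta>: "integrable lborel (\<lambda>x. (max 0 (Z x))\<^sup>2 - (P x)\<^sup>2)"
    using square_integrable_sq[OF ZP] square_integrable_sq[OF P] by simp
  have intPq: "integrable lborel (\<lambda>x. P x * q x)"
    using P q by (rule square_integrable_mult)
  have lower: "2 * h * I \<le> \<Delta>"
  proof -
    have "2 * h * I = (LINT x|lborel. 2 * h * (P x * q x))"
      by (simp add: I_def)
    also have "\<dots> \<le> \<Delta>"
      unfolding \<Delta>
    proof (rule integral_mono)
      show "2 * h * (P x * q x) \<le> (max 0 (Z x))\<^sup>2 - (P x)\<^sup>2" for x
        using pos_part_square_increment(1)[of "X x" "h * q x"] by (simp add: P_def Zq mult_ac)
    qed (use intPq int\<Delta> in auto)
    finally show ?thesis .
  qed
  have upper: "\<Delta> \<le> 2 * h * I + h\<^sup>2 * (L2_norm q)\<^sup>2"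
  proof -
    have "\<Delta> \<le> (LINT x|lborel. 2 * h * (P x * q x) + h\<^sup>2 * (q x)\<^sup>2)"
      unfolding \<Delta>
    proof (rule integral_mono)
      show "(max 0 (Z x))\<^sup>2 - (P x)\<^sup>2 \<le> 2 * h * (P x * q x) + h\<^sup>2 * (q x)\<^sup>2" for x
        using pos_part_square_increment(2)[of "X x" "h * q x"]
        by (simp add: P_def Zq mult_ac power_mult_distrib)
    qed (use intPq int\<Delta> square_integrable_sq[OF q] in auto)
    also have "\<dots> = 2 * h * I + h\<^sup>2 * (L2_norm q)\<^sup>2"
      using intPq square_integrable_sq[OF q] by (simp add: I_def L2_norm_power2)
    finally show ?thesis .
  qed
  \<comment> \<open>For h > 0 the upper estimate of the increment is divided by h; for h < 0
    division reverses the inequality, so the lower estimate is the one to use.\<close>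
  have "\<Delta> / h \<le> 2 * I + \<bar>h\<bar> * (L2_norm q)\<^sup>2"
  proof (cases "h > 0")
    case True
    then show ?thesis using upper by (simp add: field_simps power2_eq_square)
  next
    case False
    then have "h < 0" using \<open>h \<noteq> 0\<close> by simp
    then have "\<Delta> / h \<le> 2 * I" using lower by (simp add: field_simps)
    moreover have "0 \<le> \<bar>h\<bar> * (L2_norm q)\<^sup>2" by simp
    ultimately show ?thesis by linarith
  qed
  moreover have "I \<le> (LINT x|lborel. P x * D x) + L2_norm P * r"
  proof -
    have qD: "(\<lambda>x. q x - D x) \<in> square_integrable"
      using q D by (rule square_integrable_diff)
    have "I = (LINT x|lborel. P x * D x + P x * (q x - D x))"
      by (simp add: I_def algebra_simps)
    also have "\<dots> = (LINT x|lborel. P x * D x) + (LINT x|lborel. P x * (q x - D x))"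
      using P D qD by (intro Bochner_Integration.integral_add square_integrable_mult)
    also have "(LINT x|lborel. P x * (q x - D x)) \<le> L2_norm P * r"
      using L2_norm_Cauchy_Schwarz[OF P qD] by (simp add: r_def q_def)
    finally show ?thesis by simp
  qed
  moreover have "\<bar>h\<bar> * (L2_norm q)\<^sup>2 \<le> \<bar>h\<bar> * (L2_norm D + r)\<^sup>2"
  proof -
    have "L2_norm (\<lambda>x. D x + (q x - D x)) \<le> L2_norm D + L2_norm (\<lambda>x. q x - D x)"
      using q D by (intro L2_norm_triangle square_integrable_intros)
    then have "L2_norm q \<le> L2_norm D + r"
      by (simp add: r_def q_def[abs_def])
    then show ?thesis
      by (intro mult_left_mono power_mono) (auto simp: L2_norm_nonneg)
  qed
  ultimately show ?thesis
    unfolding \<Delta>_def by linarith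
qed

lemma pos_part_energy_upper_derivative:
  fixes X :: "real \<Rightarrow> 'a::euclidean_space \<Rightarrow> real"
  assumes X: "\<And>s. s > 0 \<Longrightarrow> X s \<in> square_integrable" and D: "D \<in> square_integrable"
    and deriv: "has_L2_time_derivative X D t" and "t > 0"
    and dissipative: "(LINT x|lborel. max 0 (X t x) * D x) \<le> 0" and "\<eta> > 0"
  shows "\<forall>\<^sub>F h in at 0. ((L2_norm (\<lambda>x. max 0 (X (t + h) x)))\<^sup>2 - (L2_norm (\<lambda>x. max 0 (X t x)))\<^sup>2) / h \<le> \<eta>"
proof -
  define r where "r h = L2_norm (\<lambda>x. (X (t + h) x - X t x) / h - D x)" for h
  define B where "B h = 2 * L2_norm (\<lambda>x. max 0 (X t x)) * r h + \<bar>h\<bar> * (L2_norm D + r h)\<^sup>2" for h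
  have [tendsto_intros]: "(r \<longlongrightarrow> 0) (at 0)"
    using deriv by (simp add: has_L2_time_derivative_def r_def[abs_def])
  have "(B \<longlongrightarrow> 2 * L2_norm (\<lambda>x. max 0 (X t x)) * 0 + \<bar>0\<bar> * (L2_norm D + 0)\<^sup>2) (at 0)"
    unfolding B_def by (intro tendsto_intros)
  then have "\<forall>\<^sub>F h in at 0. B h < \<eta>"
    using \<open>\<eta> > 0\<close> by (intro order_tendstoD) auto
  moreover have "\<forall>\<^sub>F h in at 0. h \<noteq> (0::real)"
    by (simp add: eventually_at_filter)
  moreover have "\<forall>\<^sub>F h in at 0. t + h > 0"
  proof -
    have "((\<lambda>h. t + h) \<longlongrightarrow> t + 0) (at 0)" by (intro tendsto_intros)
    then show ?thesis using \<open>t > 0\<close> by (intro order_tendstoD) auto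
  qed
  ultimately show ?thesis
  proof eventually_elim
    case (elim h)
    then show ?case
      using pos_part_difference_quotient[OF X[OF \<open>t > 0\<close>] X[of "t + h"] D, of h] dissipative
      unfolding B_def r_def by linarith
  qed
qed

text \<open>The norm of the positive part inherits absolute continuity from the curve, being
  1-Lipschitz in L2. So does its square, because squaring is Lipschitz on bounded sets.\<close>

lemma pos_part_energy_nonincreasing:
  fixes X :: "real \<Rightarrow> 'a::euclidean_space \<Rightarrow> real"
  assumes X: "\<And>s. s > 0 \<Longrightarrow> X s \<in> square_integrable"
    and ac: "L2_absolutely_continuous \<alpha> \<beta> X" and "0 < \<alpha>" "\<alpha> \<le> \<beta>"
    and deriv: "AE t in lborel. t > 0 \<longrightarrow> (\<exists>D\<in>square_integrable. has_L2_time_derivative X D t \<and>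
      (LINT x|lborel. max 0 (X t x) * D x) \<le> 0)"
  shows "L2_norm (\<lambda>x. max 0 (X \<beta> x)) \<le> L2_norm (\<lambda>x. max 0 (X \<alpha> x))"
proof -
  define N where "N t = L2_norm (\<lambda>x. max 0 (X t x))" for t
  have N_diff: "\<bar>N b - N a\<bar> \<le> L2_norm (\<lambda>x. X b x - X a x)" if "a > 0" "b > 0" for a b
    unfolding N_def using X that by (intro L2_norm_pos_part_diff) auto
  \<comment> \<open>A single interval in the definition of absolute continuity already gives
    continuity; compactness then supplies the bound M.\<close>
  have "uniformly_continuous_on {\<alpha>..\<beta>} N"
    unfolding uniformly_continuous_on_def
  proof (intro allI impI)
    fix e :: real assume "e > 0"
    then obtain \<delta> where "\<delta> > 0" and \<delta>: "\<And>(n::nat) a b.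
        (\<forall>i<n. \<alpha> \<le> a i \<and> a i \<le> b i \<and> b i \<le> \<beta>) \<and> (\<forall>j<n. \<forall>i<j. b i \<le> a j) \<and>
        (\<Sum>i<n. b i - a i) < \<delta> \<Longrightarrow> (\<Sum>i<n. L2_norm (\<lambda>x. X (b i) x - X (a i) x)) < e"
      using ac unfolding L2_absolutely_continuous_def by blast
    have *: "\<bar>N b - N a\<bar> < e" if "\<alpha> \<le> a" "a \<le> b" "b \<le> \<beta>" "b - a < \<delta>" for a b
    proof -
      have "L2_norm (\<lambda>x. X b x - X a x) < e"
        using \<delta>[of 1 "\<lambda>_. a" "\<lambda>_. b"] that by simp
      then show ?thesis using N_diff[of a b] that \<open>0 < \<alpha>\<close> by simp
    qed
    have "dist (N x') (N x) < e" if "x \<in> {\<alpha>..\<beta>}" "x' \<in> {\<alpha>..\<beta>}" "dist x' x < \<delta>" for x x'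
      using *[of x x'] *[of x' x] that by (cases "x \<le> x'") (auto simp: dist_real_def)
    then show "\<exists>d>0. \<forall>x\<in>{\<alpha>..\<beta>}. \<forall>x'\<in>{\<alpha>..\<beta>}. dist x' x < d \<longrightarrow> dist (N x') (N x) < e"
      using \<open>\<delta> > 0\<close> by blast
  qed
  then have "bounded (N ` {\<alpha>..\<beta>})"
    by (intro compact_imp_bounded compact_continuous_image uniformly_continuous_imp_continuous) auto
  then obtain M where "M > 0" and M: "\<And>t. t \<in> {\<alpha>..\<beta>} \<Longrightarrow> \<bar>N t\<bar> \<le> M"
    unfolding bounded_pos by auto
  have "(N \<beta>)\<^sup>2 \<le> (N \<alpha>)\<^sup>2"
  proof (rule absolutely_continuous_nonincreasing[OF \<open>\<alpha> \<le> \<beta>\<close>])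
    fix \<epsilon> :: real assume "\<epsilon> > 0"
    \<comment> \<open>The squares of two values of N differ by at most 2M times the difference of
      the values.\<close>
    then have "\<epsilon> / (2 * M) > 0" using \<open>M > 0\<close> by simp
    then obtain \<delta> where "\<delta> > 0" and \<delta>: "\<And>(n::nat) a b.
        (\<forall>i<n. \<alpha> \<le> a i \<and> a i \<le> b i \<and> b i \<le> \<beta>) \<and> (\<forall>j<n. \<forall>i<j. b i \<le> a j) \<and>
        (\<Sum>i<n. b i - a i) < \<delta> \<Longrightarrow> (\<Sum>i<n. L2_norm (\<lambda>x. X (b i) x - X (a i) x)) < \<epsilon> / (2 * M)"
      using ac unfolding L2_absolutely_continuous_def by blast
    have "(\<Sum>i<n. \<bar>(N (b i))\<^sup>2 - (N (a i))\<^sup>2\<bar>) < \<epsilon>"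
      if ab: "(\<forall>i<n. \<alpha> \<le> a i \<and> a i \<le> b i \<and> b i \<le> \<beta>) \<and> (\<forall>j<n. \<forall>i<j. b i \<le> a j) \<and>
        (\<Sum>i<n. b i - a i) < \<delta>" for n :: nat and a b
    proof -
      have "(\<Sum>i<n. \<bar>(N (b i))\<^sup>2 - (N (a i))\<^sup>2\<bar>) \<le> (\<Sum>i<n. 2 * M * L2_norm (\<lambda>x. X (b i) x - X (a i) x))"
      proof (rule sum_mono)
        fix i assume "i \<in> {..<n}"
        then have i: "a i \<in> {\<alpha>..\<beta>}" "b i \<in> {\<alpha>..\<beta>}" using ab by force+
        have "\<bar>(N (b i))\<^sup>2 - (N (a i))\<^sup>2\<bar> = \<bar>N (b i) + N (a i)\<bar> * \<bar>N (b i) - N (a i)\<bar>"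
          unfolding abs_mult[symmetric] by (simp add: power2_eq_square algebra_simps)
        also have "\<dots> \<le> 2 * M * L2_norm (\<lambda>x. X (b i) x - X (a i) x)"
          using M[OF i(1)] M[OF i(2)] N_diff[of "a i" "b i"] i \<open>0 < \<alpha>\<close> \<open>M > 0\<close>
          by (intro mult_mono) auto
        finally show "\<bar>(N (b i))\<^sup>2 - (N (a i))\<^sup>2\<bar> \<le> 2 * M * L2_norm (\<lambda>x. X (b i) x - X (a i) x)" .
      qed
      also have "\<dots> < \<epsilon>"
        using \<delta>[OF ab] \<open>M > 0\<close> by (simp add: sum_distrib_left[symmetric] field_simps)
      finally show ?thesis .
    qed
    then show "\<exists>\<delta>>0. \<forall>(n::nat) a b.
        (\<forall>i<n. \<alpha> \<le> a i \<and> a i \<le> b i \<and> b i \<le> \<beta>) \<and> (\<forall>j<n. \<forall>i<j. b i \<le> a j) \<and>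
        (\<Sum>i<n. b i - a i) < \<delta> \<longrightarrow> (\<Sum>i<n. \<bar>(N (b i))\<^sup>2 - (N (a i))\<^sup>2\<bar>) < \<epsilon>"
      using \<open>\<delta> > 0\<close> by (intro exI[of _ \<delta>]) blast
  next
    show "AE t in lborel. t \<in> {\<alpha>..\<beta>} \<longrightarrow>
        (\<forall>\<eta>>0. \<forall>\<^sub>F h in at 0. ((N (t + h))\<^sup>2 - (N t)\<^sup>2) / h \<le> \<eta>)"
      using deriv
    proof eventually_elim
      case (elim t)
      show ?case
      proof (intro impI allI)
        fix \<eta> :: real assume t: "t \<in> {\<alpha>..\<beta>}" and "\<eta> > 0"
        then have "t > 0" using \<open>0 < \<alpha>\<close> by simp
        then obtain D where "D \<in> square_integrable" "has_L2_time_derivative X D t"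
          "(LINT x|lborel. max 0 (X t x) * D x) \<le> 0" using elim by blast
        then show "\<forall>\<^sub>F h in at 0. ((N (t + h))\<^sup>2 - (N t)\<^sup>2) / h \<le> \<eta>"
          unfolding N_def using pos_part_energy_upper_derivative[of X D t \<eta>] X \<open>t > 0\<close> \<open>\<eta> > 0\<close> by blast
      qed
    qed
  qed
  then show ?thesis
    by (auto simp: N_def L2_norm_nonneg intro: power2_le_imp_le)
qed

text \<open>Absolute continuity is available only on compact subintervals of (0, \<infinity>), so
  time 0 is reached by letting the starting time s decrease to 0 and using continuity in L2.\<close>

lemma pos_part_energy_le_initial:
  fixes X :: "real \<Rightarrow> 'a::euclidean_space \<Rightarrow> real"
  assumes X: "\<And>s. s \<ge> 0 \<Longrightarrow> X s \<in> square_integrable"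
    and ac: "\<And>\<alpha> \<beta>. 0 < \<alpha> \<Longrightarrow> \<alpha> < \<beta> \<Longrightarrow> L2_absolutely_continuous \<alpha> \<beta> X"
    and deriv: "AE t in lborel. t > 0 \<longrightarrow> (\<exists>D\<in>square_integrable. has_L2_time_derivative X D t \<and>
      (LINT x|lborel. max 0 (X t x) * D x) \<le> 0)"
    and cont: "((\<lambda>t. L2_norm (\<lambda>x. X t x - X 0 x)) \<longlongrightarrow> 0) (at_right 0)"
    and "t > 0"
  shows "L2_norm (\<lambda>x. max 0 (X t x)) \<le> L2_norm (\<lambda>x. max 0 (X 0 x))"
proof (rule tendsto_lowerbound)
  show "((\<lambda>s. L2_norm (\<lambda>x. max 0 (X 0 x)) + L2_norm (\<lambda>x. X s x - X 0 x)) \<longlongrightarrow>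
    L2_norm (\<lambda>x. max 0 (X 0 x))) (at_right 0)"
    using tendsto_add[OF tendsto_const cont] by simp
  have "\<forall>\<^sub>F s in at_right 0. s \<in> {0<..<t}"
    using \<open>t > 0\<close> by (rule eventually_at_right_real)
  then show "\<forall>\<^sub>F s in at_right 0. L2_norm (\<lambda>x. max 0 (X t x)) \<le>
      L2_norm (\<lambda>x. max 0 (X 0 x)) + L2_norm (\<lambda>x. X s x - X 0 x)"
  proof eventually_elim
    case (elim s)
    then have "L2_norm (\<lambda>x. max 0 (X t x)) \<le> L2_norm (\<lambda>x. max 0 (X s x))"
      using X ac deriv by (intro pos_part_energy_nonincreasing) auto
    moreover have "L2_norm (\<lambda>x. max 0 (X s x)) \<le> L2_norm (\<lambda>x. max 0 (X 0 x)) + L2_norm (\<lambda>x. X s x - X 0 x)"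
      using L2_norm_pos_part_diff[of "X s" "X 0"] X elim by simp
    ultimately show ?case by simp
  qed
qed simp

section \<open>Test functions\<close>

lemma Ck_on_UNIV_Suc_imp: "Ck_on (Suc k) UNIV f \<Longrightarrow> Ck_on k UNIV f"
proof (induction k arbitrary: f)
  case 0
  then show ?case
    by (auto intro!: continuous_at_imp_continuous_on differentiable_imp_continuous_within)
next
  case (Suc k)
  have "Ck_on k UNIV (\<lambda>x. frechet_derivative f (at x) v)" for v
    using Suc.prems by (intro Suc.IH) simp
  moreover have "\<forall>x\<in>UNIV. f differentiable (at x)"
    using Suc.prems by simp
  ultimately show ?case by simp
qed

text \<open>By uniqueness of derivatives an explicit formula may stand in for
  \<open>frechet_derivative\<close>.\<close>

lemma Ck_on_UNIV_SucI:
  assumes "\<And>x. (f has_derivative f' x) (at x)" "\<And>v. Ck_on k UNIV (\<lambda>x. f' x v)"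
  shows "Ck_on (Suc k) UNIV f"
proof -
  have "frechet_derivative f (at x) = f' x" for x
    using frechet_derivative_at[OF assms(1)] by simp
  then show ?thesis
    using assms by (auto simp: differentiable_def)
qed

lemma Ck_on_UNIV_SucD:
  assumes "Ck_on (Suc k) UNIV f"
  shows "(f has_derivative frechet_derivative f (at x)) (at x)"
    and "Ck_on k UNIV (\<lambda>x. frechet_derivative f (at x) v)"
  using assms by (auto simp: frechet_derivative_works[symmetric])

lemma Ck_on_UNIV_const: "Ck_on k UNIV (\<lambda>x. c)"
proof (induction k arbitrary: c)
  case (Suc k)
  show ?case
    by (rule Ck_on_UNIV_SucI[of _ "\<lambda>x v. 0"]) (auto intro: Suc.IH)
qed simp

lemma Ck_on_UNIV_add:
  assumes "Ck_on k UNIV f" "Ck_on k UNIV g"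
  shows "Ck_on k UNIV (\<lambda>x. f x + g x)"
  using assms
proof (induction k arbitrary: f g)
  case (Suc k)
  note D = Ck_on_UNIV_SucD[OF Suc.prems(1)] Ck_on_UNIV_SucD[OF Suc.prems(2)]
  show ?case
    by (rule Ck_on_UNIV_SucI[OF has_derivative_add[OF D(1,3)]]) (intro Suc.IH D)
qed (auto intro: continuous_intros)

lemma Ck_on_UNIV_mult:
  fixes f g :: "'a::real_normed_vector \<Rightarrow> real"
  assumes "Ck_on k UNIV f" "Ck_on k UNIV g"
  shows "Ck_on k UNIV (\<lambda>x. f x * g x)"
  using assms
proof (induction k arbitrary: f g)
  case (Suc k)
  note D = Ck_on_UNIV_SucD[OF Suc.prems(1)] Ck_on_UNIV_SucD[OF Suc.prems(2)]
  show ?case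
    by (rule Ck_on_UNIV_SucI[OF has_derivative_mult[OF D(1,3)]])
      \<comment> \<open>The product rule leaves an undifferentiated factor beside each derivative;
        its order is lowered by one to meet the induction hypothesis.\<close>
      (intro Ck_on_UNIV_add Suc.IH D Ck_on_UNIV_Suc_imp[OF Suc.prems(1)] Ck_on_UNIV_Suc_imp[OF Suc.prems(2)])
qed (auto intro: continuous_intros)

text \<open>The exponent is generalised in the induction because differentiation lowers it by one.
  Positivity of \<open>f\<close> avoids the singularity of powers at 0.\<close>

lemma Ck_on_UNIV_powr:
  fixes f :: "'a::real_normed_vector \<Rightarrow> real"
  assumes "Ck_on k UNIV f" "\<And>x. f x > 0"
  shows "Ck_on k UNIV (\<lambda>x. f x powr a)"
  using assms(1)
proof (induction k arbitrary: a)
  case 0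
  have "\<And>x. f x \<noteq> 0" using assms(2) by (metis less_irrefl)
  with 0 show ?case by (auto intro!: continuous_intros)
next
  case (Suc k)
  note D = Ck_on_UNIV_SucD[OF Suc.prems(1)]
  have "((\<lambda>x. f x powr a) has_derivative (\<lambda>v. frechet_derivative f (at x) v * (a * f x powr (a - 1)))) (at x)" for x
    using DERIV_compose_FDERIV[OF has_real_derivative_powr[OF assms(2)] D(1)] .
  then show ?case
    by (rule Ck_on_UNIV_SucI)
      (intro Ck_on_UNIV_mult D Ck_on_UNIV_const Suc.IH Ck_on_UNIV_Suc_imp[OF Suc.prems(1)])
qed

text \<open>Regularises \<open>max 0 t\<close>, which is half of t + |t|, by replacing |t| with a
  branch of a hyperbola. Subtracting e makes the value at 0 vanish, so composition does not enlarge
  supports.\<close>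

definition smooth_pos_part :: "real \<Rightarrow> real \<Rightarrow> real" where
  "smooth_pos_part e t = (t + sqrt (t\<^sup>2 + e\<^sup>2) - e) / 2"

lemma smooth_pos_part_zero: "e \<ge> 0 \<Longrightarrow> smooth_pos_part e 0 = 0"
  by (simp add: smooth_pos_part_def)

text \<open>The square root is the modulus of the complex number a + ie, so the reverse triangle
  inequality applies. The constant 1 is what lets increments of a truncation be dominated by those
  of the original function.\<close>

lemma smooth_pos_part_lipschitz: "\<bar>smooth_pos_part e a - smooth_pos_part e b\<bar> \<le> \<bar>a - b\<bar>"
proof -
  have "\<bar>norm (Complex a e) - norm (Complex b e)\<bar> \<le> norm (Complex a e - Complex b e)"
    by (rule norm_triangle_ineq3)
  then have "\<bar>sqrt (a\<^sup>2 + e\<^sup>2) - sqrt (b\<^sup>2 + e\<^sup>2)\<bar> \<le> \<bar>a - b\<bar>"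
    by (simp add: complex_norm complex_diff)
  moreover have "smooth_pos_part e a - smooth_pos_part e b =
      ((a - b) + (sqrt (a\<^sup>2 + e\<^sup>2) - sqrt (b\<^sup>2 + e\<^sup>2))) / 2"
    by (simp add: smooth_pos_part_def field_simps)
  ultimately show ?thesis
    using abs_triangle_ineq[of "a - b" "sqrt (a\<^sup>2 + e\<^sup>2) - sqrt (b\<^sup>2 + e\<^sup>2)"] by simp
qed

lemma smooth_pos_part_approx:
  assumes "e \<ge> 0"
  shows "\<bar>smooth_pos_part e t - max 0 t\<bar> \<le> e"
proof -
  have "\<bar>t\<bar> \<le> sqrt (t\<^sup>2 + e\<^sup>2)"
    by (rule real_le_rsqrt) simp
  moreover have "sqrt (t\<^sup>2 + e\<^sup>2) \<le> \<bar>t\<bar> + e"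
    using sqrt_sum_squares_le_sum_abs[of t e] assms by simp
  moreover have eq: "smooth_pos_part e t - max 0 t = (sqrt (t\<^sup>2 + e\<^sup>2) - \<bar>t\<bar> - e) / 2"
    by (simp add: smooth_pos_part_def max_def field_simps)
  moreover have "\<bar>(S - T - e) / 2\<bar> \<le> e" if "T \<le> S" "S \<le> T + e" for S T :: real
    using that assms by (simp add: abs_le_iff field_simps)
  ultimately show ?thesis
    unfolding eq by blast
qed

lemma test_functions_shrink_support:
  assumes "\<phi> \<in> test_functions \<Omega>" "smooth_on UNIV \<psi>" "\<And>x. \<phi> x = 0 \<Longrightarrow> \<psi> x = 0"
  shows "\<psi> \<in> test_functions \<Omega>"
proof -
  have "closure {x. \<psi> x \<noteq> 0} \<subseteq> closure {x. \<phi> x \<noteq> 0}"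
    using assms(3) by (intro closure_mono) auto
  then show ?thesis
    using assms unfolding test_functions_def
    by (auto simp: compact_closure intro: bounded_subset[of "{x. \<phi> x \<noteq> 0}"])
qed

lemma test_functions_diff:
  assumes "\<phi> \<in> test_functions \<Omega>" "\<psi> \<in> test_functions \<Omega>"
  shows "(\<lambda>x. \<phi> x - \<psi> x) \<in> test_functions \<Omega>"
proof -
  have "Ck_on k UNIV (\<lambda>x. \<phi> x + (- 1) * \<psi> x)" for k
    using assms unfolding smooth_on_def test_functions_def
    by (intro Ck_on_UNIV_add Ck_on_UNIV_mult Ck_on_UNIV_const) auto
  then have "smooth_on UNIV (\<lambda>x. \<phi> x - \<psi> x)"
    by (simp add: smooth_on_def)
  moreover have "closure {x. \<phi> x - \<psi> x \<noteq> 0} \<subseteq> closure {x. \<phi> x \<noteq> 0} \<union> closure {x. \<psi> x \<noteq> 0}"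
    unfolding closure_Un[symmetric] by (intro closure_mono) auto
  ultimately show ?thesis
    using assms unfolding test_functions_def
    by (auto simp: compact_closure intro: bounded_subset[of "{x. \<phi> x \<noteq> 0} \<union> {x. \<psi> x \<noteq> 0}"])
qed

lemma test_functions_cmult:
  assumes "\<phi> \<in> test_functions \<Omega>"
  shows "(\<lambda>x. c * \<phi> x) \<in> test_functions \<Omega>"
proof (rule test_functions_shrink_support[OF assms])
  show "smooth_on UNIV (\<lambda>x. c * \<phi> x)"
    using assms unfolding smooth_on_def test_functions_def
    by (auto intro!: Ck_on_UNIV_mult Ck_on_UNIV_const)
qed simp

lemma test_functions_smooth_pos_part:
  assumes "\<phi> \<in> test_functions \<Omega>" "e > 0"
  shows "(\<lambda>x. smooth_pos_part e (\<phi> x)) \<in> test_functions \<Omega>"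
proof (rule test_functions_shrink_support[OF assms(1)])
  have pos: "\<phi> x * \<phi> x + e\<^sup>2 > 0" for x
    using assms(2) by (intro add_nonneg_pos) auto
  \<comment> \<open>Written with \<open>powr\<close> and products so that the C^k rules apply; the
    base is at least \<open>e\<^sup>2\<close>, hence positive.\<close>
  have "smooth_pos_part e (\<phi> x) = (\<phi> x + (\<phi> x * \<phi> x + e\<^sup>2) powr (1 / 2) + (- e)) * (1 / 2)" for x
    using pos[of x] unfolding smooth_pos_part_def by (simp add: powr_half_sqrt power2_eq_square)
  moreover have "Ck_on k UNIV (\<lambda>x. (\<phi> x + (\<phi> x * \<phi> x + e\<^sup>2) powr (1 / 2) + (- e)) * (1 / 2))" for k
    using assms(1) pos unfolding smooth_on_def test_functions_def
    by (intro Ck_on_UNIV_mult Ck_on_UNIV_add Ck_on_UNIV_powr Ck_on_UNIV_const) auto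
  ultimately show "smooth_on UNIV (\<lambda>x. smooth_pos_part e (\<phi> x))"
    unfolding smooth_on_def by presburger
qed (use assms(2) in \<open>simp add: smooth_pos_part_zero\<close>)

lemma test_functions_continuous: "\<phi> \<in> test_functions \<Omega> \<Longrightarrow> continuous_on UNIV \<phi>"
  by (auto simp: test_functions_def smooth_on_def dest!: spec[of _ 0])

lemma test_functions_borel [measurable_dest]: "\<phi> \<in> test_functions \<Omega> \<Longrightarrow> \<phi> \<in> borel_measurable borel"
  by (intro borel_measurable_continuous_onI test_functions_continuous)

lemma continuous_compact_support_bounded:
  fixes f :: "'a::euclidean_space \<Rightarrow> real"
  assumes "continuous_on UNIV f" "compact K" "\<And>x. x \<notin> K \<Longrightarrow> f x = 0"
  obtains M where "M \<ge> 0" "\<And>x. \<bar>f x\<bar> \<le> M"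
proof -
  have "bounded (f ` K)"
    using assms by (intro compact_imp_bounded compact_continuous_image) (auto intro: continuous_on_subset)
  then obtain M where M: "M > 0" "\<And>x. x \<in> K \<Longrightarrow> \<bar>f x\<bar> \<le> M"
    unfolding bounded_pos by auto
  have "\<bar>f x\<bar> \<le> M" for x
    using M assms(3)[of x] by (cases "x \<in> K") auto
  then show ?thesis using that[of M] M by simp
qed

text \<open>Both arguments of the minimum are used: linear smallness near the diagonal tames the
  singular kernel, boundedness serves far from it.\<close>

lemma test_functions_lipschitz:
  fixes \<phi> :: "'a::euclidean_space \<Rightarrow> real"
  assumes "\<phi> \<in> test_functions \<Omega>"
  obtains L where "L \<ge> 0" "\<And>x y. \<bar>\<phi> x - \<phi> y\<bar> \<le> L * min 1 (norm (x - y))"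
proof -
  define K where "K = closure {x. \<phi> x \<noteq> 0}"
  have zero: "\<phi> x = 0" if "x \<notin> K" for x
    using closure_subset[of "{x. \<phi> x \<noteq> 0}"] that by (auto simp: K_def)
  have "compact K" using assms by (simp add: test_functions_def K_def)
  have "Ck_on (Suc 0) UNIV \<phi>"
    using assms by (simp add: test_functions_def smooth_on_def del: Ck_on.simps)
  note D = Ck_on_UNIV_SucD[OF this]
  have D0: "frechet_derivative \<phi> (at x) v = 0" if "x \<notin> K" for x v
  proof -
    have "open (- K)" unfolding K_def by (intro open_Compl closed_closure)
    then have "(\<phi> has_derivative (\<lambda>v. 0)) (at x)"
      by (rule has_derivative_transform_within_open[OF has_derivative_const]) (use that zero in auto)
    then show ?thesis
      using frechet_derivative_at by metis
  qed
  have "\<exists>B\<ge>0. \<forall>x. \<bar>frechet_derivative \<phi> (at x) v\<bar> \<le> B" for v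
  proof (rule continuous_compact_support_bounded)
    show "continuous_on UNIV (\<lambda>x. frechet_derivative \<phi> (at x) v)"
      using D(2) by simp
  qed (use D0 \<open>compact K\<close> in auto)
  then obtain B where B: "\<And>v. B v \<ge> 0" "\<And>v x. \<bar>frechet_derivative \<phi> (at x) v\<bar> \<le> B v"
    by metis
  \<comment> \<open>\<open>Ck_on\<close> gives continuity of each directional derivative separately.
    Expanding a direction in the basis turns the bounds for basis vectors into one for the operator
    norm.\<close>
  define L where "L = (\<Sum>b\<in>Basis. B b)"
  have "L \<ge> 0" unfolding L_def using B by (simp add: sum_nonneg)
  have onorm: "onorm (frechet_derivative \<phi> (at x)) \<le> L" for x
  proof (rule onorm_le)
    fix v
    have lin: "linear (frechet_derivative \<phi> (at x))"
      using D(1) has_derivative_linear by blast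
    have "frechet_derivative \<phi> (at x) v = frechet_derivative \<phi> (at x) (\<Sum>b\<in>Basis. (v \<bullet> b) *\<^sub>R b)"
      by (simp add: euclidean_representation)
    also have "\<dots> = (\<Sum>b\<in>Basis. (v \<bullet> b) * frechet_derivative \<phi> (at x) b)"
      using lin by (simp add: linear_sum linear_cmul)
    finally have "\<bar>frechet_derivative \<phi> (at x) v\<bar> \<le> (\<Sum>b\<in>Basis. \<bar>(v \<bullet> b) * frechet_derivative \<phi> (at x) b\<bar>)"
      by (simp add: sum_abs)
    also have "\<dots> \<le> (\<Sum>b\<in>Basis. B b * norm v)"
      using B by (intro sum_mono) (auto simp: abs_mult mult.commute[of "B _"] intro!: mult_mono Basis_le_norm)
    finally show "norm (frechet_derivative \<phi> (at x) v) \<le> L * norm v"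
      by (simp add: L_def sum_distrib_right)
  qed
  have lip: "\<bar>\<phi> x - \<phi> y\<bar> \<le> L * norm (x - y)" for x y
    using differentiable_bound[of UNIV \<phi> "\<lambda>x. frechet_derivative \<phi> (at x)" L x y] D(1) onorm by simp
  obtain M where M: "M \<ge> 0" "\<And>x. \<bar>\<phi> x\<bar> \<le> M"
    using continuous_compact_support_bounded[OF test_functions_continuous[OF assms] \<open>compact K\<close>] zero by blast
  show ?thesis
  proof
    show "0 \<le> max L (2 * M)" using M by simp
    fix x y
    show "\<bar>\<phi> x - \<phi> y\<bar> \<le> max L (2 * M) * min 1 (norm (x - y))"
    proof (cases "norm (x - y) \<le> 1")
      case True
      have "L * norm (x - y) \<le> max L (2 * M) * norm (x - y)"
        by (intro mult_right_mono) auto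
      then show ?thesis using lip[of x y] True by simp
    next
      case False
      have "\<bar>\<phi> x - \<phi> y\<bar> \<le> 2 * M" using M(2)[of x] M(2)[of y] by linarith
      then show ?thesis using False by simp
    qed
  qed
qed

section \<open>Finite energy of test functions\<close>

lemma suminf_exponential_finite:
  fixes C c d :: real
  assumes "d > 0" "C \<ge> 0"
  shows "(\<Sum>k. ennreal (C * 2 powr (c - real k * d))) < \<infinity>"
proof -
  have "C * 2 powr (c - real k * d) = C * 2 powr c * (2 powr (- d)) ^ k" for k
  proof -
    have "c - real k * d = c + - d * real k" by simp
    then show ?thesis by (simp only: powr_add powr_powr[symmetric] powr_realpow[OF powr_gt_zero[THEN iffD2]])
  qed
  moreover have "summable (\<lambda>k. C * 2 powr c * (2 powr (- d)) ^ k)"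
    using assms powr_less_mono[of "-d" 0 2] by (intro summable_mult summable_geometric) auto
  ultimately have "summable (\<lambda>k. C * 2 powr (c - real k * d))"
    by (simp only:)
  then show ?thesis
    using assms by (subst suminf_ennreal2) auto
qed

text \<open>Minimality of k yields the upper bound; for k = 0 the hypothesis r <= 1 takes its
  place.\<close>

lemma dyadic_small:
  fixes r :: real
  assumes "0 < r" "r \<le> 1"
  obtains k :: nat where "2 powr (- real (Suc k)) < r" "r \<le> 2 powr (- real k)"
proof -
  have pw: "2 powr (- real k) = (1 / 2) ^ k" for k
    by (simp add: powr_minus powr_realpow power_one_over inverse_eq_divide)
  obtain n where "(1 / 2) ^ n < r"
    using real_arch_pow_inv[of r "1 / 2"] assms by auto
  define k where "k = (LEAST k. (1 / 2) ^ Suc k < r)"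
  have "(1 / 2) ^ Suc n < r"
    using \<open>(1 / 2) ^ n < r\<close> power_decreasing[of n "Suc n" "1 / 2 :: real"] by linarith
  then have k: "(1 / 2) ^ Suc k < r"
    unfolding k_def by (rule LeastI)
  have "r \<le> (1 / 2) ^ k"
  proof (cases k)
    case (Suc j)
    then have "\<not> (1 / 2) ^ Suc j < r"
      using not_less_Least[of j "\<lambda>k. (1 / 2) ^ Suc k < r"] by (simp add: k_def)
    then show ?thesis using Suc by simp
  qed (use assms in simp)
  with k show ?thesis
    using that[of k] unfolding pw by simp
qed

lemma dyadic_large:
  fixes r :: real
  assumes "1 < r"
  obtains k :: nat where "2 powr (real k) < r" "r \<le> 2 powr (real (Suc k))"
proof -
  obtain n where "r < 2 ^ n"
    using real_arch_pow[of 2 r] by auto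
  define k where "k = (LEAST k. r \<le> 2 ^ Suc k)"
  have "r \<le> 2 ^ Suc n"
    using \<open>r < 2 ^ n\<close> by (simp add: order.trans[of r "2 ^ n"])
  then have k: "r \<le> 2 ^ Suc k"
    unfolding k_def by (rule LeastI)
  have "2 ^ k < r"
  proof (cases k)
    case (Suc j)
    then have "\<not> r \<le> 2 ^ Suc j"
      using not_less_Least[of j "\<lambda>k. r \<le> 2 ^ Suc k"] by (simp add: k_def)
    then show ?thesis using Suc by simp
  qed (use assms in simp)
  with k show ?thesis
    using that[of k] unfolding powr_realpow[of 2, simplified] by simp
qed

lemma ennreal_le_suminf:
  fixes f :: "nat \<Rightarrow> ennreal"
  shows "f k \<le> (\<Sum>k. f k)"
  using sum_le_suminf[of f "{k}"] by simp

text \<open>Near the origin the integrand is at most \<open>\<bar>z\<bar> powr (p - sp - n)\<close>, at infinity it is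
  \<open>\<bar>z\<bar> powr (- n - sp)\<close>; both are summed over dyadic balls.\<close>

lemma nn_integral_kernel_finite:
  fixes s p :: real
  assumes "0 < s" "s < 1" "0 < p"
  shows "(\<integral>\<^sup>+z. ennreal (min 1 (norm z) powr p / norm (z :: 'a::euclidean_space) powr (real DIM('a) + s * p)) \<partial>lborel) < \<infinity>"
proof -
  define n where "n = real DIM('a)"
  define \<sigma> where "\<sigma> = n + s * p"
  have "n > 0" "\<sigma> > 0" using assms by (auto simp: n_def \<sigma>_def intro!: add_pos_pos)
  define f where "f z = min 1 (norm z) powr p / norm z powr \<sigma>" for z :: 'a
  \<comment> \<open>Suprema over dyadic annuli: \<open>a\<close> takes the numerator at the outer
    and the denominator at the inner radius, while \<open>b\<close> bounds the numerator by 1. The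
    enclosing balls \<open>A\<close> and \<open>B\<close> replace the annuli since their volumes are
    explicit and of the same order.\<close>
  define a where "a k = 2 powr (- real k * p) * 2 powr (real (Suc k) * \<sigma>)" for k
  define b where "b k = 2 powr (- real k * \<sigma>)" for k
  define A where "A k = cball (0::'a) (2 powr (- real k))" for k
  define B where "B k = cball (0::'a) (2 powr (real (Suc k)))" for k
  have [measurable]: "A k \<in> sets borel" "B k \<in> sets borel" for k
    by (auto simp: A_def B_def)
  have ge: "f z \<le> a k" if "norm z \<le> 1" "2 powr (- real (Suc k)) < norm z" "norm z \<le> 2 powr (- real k)" for z k
  proof -
    have "f z \<le> (2 powr (- real k)) powr p / (2 powr (- real (Suc k))) powr \<sigma>"
      unfolding f_def using that assms \<open>\<sigma> > 0\<close>
      by (intro frac_le powr_mono2) auto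
    also have "\<dots> = a k"
      by (simp add: a_def powr_powr powr_minus[symmetric] divide_inverse algebra_simps)
    finally show ?thesis .
  qed
  have gl: "f z \<le> b k" if "1 < norm z" "2 powr (real k) < norm z" for z k
  proof -
    have "f z \<le> 1 / (2 powr (real k)) powr \<sigma>"
      unfolding f_def using that assms \<open>\<sigma> > 0\<close>
      by (intro frac_le powr_mono2) auto
    also have "\<dots> = b k"
      by (simp add: b_def powr_powr powr_minus divide_inverse)
    finally show ?thesis .
  qed
  have bound: "ennreal (f z) \<le> (\<Sum>k. ennreal (a k) * indicator (A k) z) + (\<Sum>k. ennreal (b k) * indicator (B k) z)" for z
  proof -
    consider "z = 0" | "z \<noteq> 0" "norm z \<le> 1" | "1 < norm z" by linarith
    then show ?thesis
    proof cases
      case 1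
      then show ?thesis by (simp add: f_def)
    next
      case 2
      then obtain k where k: "2 powr (- real (Suc k)) < norm z" "norm z \<le> 2 powr (- real k)"
        using dyadic_small[of "norm z"] by auto
      have "ennreal (f z) \<le> ennreal (a k) * indicator (A k) z"
        using ge[OF 2(2) k] k(2) by (simp add: A_def ennreal_leI)
      also have "\<dots> \<le> (\<Sum>k. ennreal (a k) * indicator (A k) z)"
        by (rule ennreal_le_suminf)
      finally show ?thesis by (rule order.trans) simp
    next
      case 3
      then obtain k where k: "2 powr (real k) < norm z" "norm z \<le> 2 powr (real (Suc k))"
        using dyadic_large[of "norm z"] by auto
      have "ennreal (f z) \<le> ennreal (b k) * indicator (B k) z"
        using gl[OF 3 k(1)] k(2) by (simp add: B_def ennreal_leI)
      also have "\<dots> \<le> (\<Sum>k. ennreal (b k) * indicator (B k) z)"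
        by (rule ennreal_le_suminf)
      finally show ?thesis by (rule order.trans) simp
    qed
  qed
  define \<omega> where "\<omega> = unit_ball_vol n"
  have "\<omega> \<ge> 0" by (simp add: \<omega>_def n_def)
  \<comment> \<open>The exponents collapse to geometric decay: at rate p(1 - s) towards the origin,
    which uses s < 1, and in \<open>emB\<close> at rate sp towards infinity, which uses s >
    0.\<close>
  have emA: "ennreal (a k) * emeasure lborel (A k) = ennreal (\<omega> * 2 powr (\<sigma> - real k * (p * (1 - s))))" for k
  proof -
    have "ennreal (a k) * emeasure lborel (A k) = ennreal (a k * (\<omega> * (2 powr (- real k)) powr n))"
      by (simp add: A_def emeasure_cball \<omega>_def n_def powr_realpow ennreal_mult a_def)
    also have "a k * (\<omega> * (2 powr (- real k)) powr n) = \<omega> * 2 powr (- real k * p + real (Suc k) * \<sigma> + - real k * n)"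
      by (simp only: a_def powr_powr powr_add) (simp add: mult_ac)
    also have "- real k * p + real (Suc k) * \<sigma> + - real k * n = \<sigma> - real k * (p * (1 - s))"
      by (simp add: \<sigma>_def algebra_simps)
    finally show ?thesis .
  qed
  have emB: "ennreal (b k) * emeasure lborel (B k) = ennreal (\<omega> * 2 powr (n - real k * (s * p)))" for k
  proof -
    have "ennreal (b k) * emeasure lborel (B k) = ennreal (b k * (\<omega> * (2 powr (real (Suc k))) powr n))"
      by (simp add: B_def emeasure_cball \<omega>_def n_def powr_realpow ennreal_mult b_def)
    also have "b k * (\<omega> * (2 powr (real (Suc k))) powr n) = \<omega> * 2 powr (- real k * \<sigma> + real (Suc k) * n)"
      by (simp only: b_def powr_powr powr_add) (simp add: mult_ac)
    also have "- real k * \<sigma> + real (Suc k) * n = n - real k * (s * p)"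
      by (simp add: \<sigma>_def algebra_simps)
    finally show ?thesis .
  qed
  have "(\<integral>\<^sup>+z. ennreal (f z) \<partial>lborel) \<le> (\<integral>\<^sup>+z. (\<Sum>k. ennreal (a k) * indicator (A k) z) + (\<Sum>k. ennreal (b k) * indicator (B k) z) \<partial>lborel)"
    by (intro nn_integral_mono bound)
  also have "\<dots> = (\<Sum>k. ennreal (a k) * emeasure lborel (A k)) + (\<Sum>k. ennreal (b k) * emeasure lborel (B k))"
    by (simp add: nn_integral_add nn_integral_suminf nn_integral_cmult_indicator)
  also have "\<dots> < \<infinity>"
  proof -
    have "(\<Sum>k. ennreal (\<omega> * 2 powr (\<sigma> - real k * (p * (1 - s))))) < \<infinity>"
      by (rule suminf_exponential_finite) (use assms \<open>\<omega> \<ge> 0\<close> in simp_all)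
    moreover have "(\<Sum>k. ennreal (\<omega> * 2 powr (n - real k * (s * p)))) < \<infinity>"
      by (rule suminf_exponential_finite) (use assms \<open>\<omega> \<ge> 0\<close> in simp_all)
    ultimately show ?thesis
      unfolding emA emB infinity_ennreal_def ennreal_add_less_top by (rule conjI)
  qed
  finally show ?thesis
    by (simp add: f_def n_def \<sigma>_def)
qed

lemma nn_integral_lborel_translate:
  fixes g :: "'a::euclidean_space \<Rightarrow> ennreal"
  assumes [measurable]: "g \<in> borel_measurable borel"
  shows "(\<integral>\<^sup>+y. g (y - x) \<partial>lborel) = (\<integral>\<^sup>+y. g y \<partial>lborel)"
proof -
  have "(\<integral>\<^sup>+y. g (y - x) \<partial>lborel) = (\<integral>\<^sup>+y. g (y - x) \<partial>distr lborel borel ((+) x))"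
    by (simp add: lborel_distr_plus)
  also have "\<dots> = (\<integral>\<^sup>+y. g y \<partial>lborel)"
    by (subst nn_integral_distr) auto
  finally show ?thesis .
qed

text \<open>Absorbing the kernel into a measure turns the Gagliardo seminorm into an L^p quantity of
  the increment function. Both parts of the Sobolev norm then fall under the same statements about
  \<open>p_energy\<close>. On the diagonal the density is 1 / 0 = 0.\<close>

definition gagliardo_measure :: "real \<Rightarrow> real \<Rightarrow> ('a::euclidean_space \<times> 'a) measure" where
  "gagliardo_measure p s = density (lborel \<Otimes>\<^sub>M lborel)
     (\<lambda>(x, y). ennreal (1 / norm (x - y) powr (real DIM('a) + s * p)))"

definition p_energy :: "real \<Rightarrow> 'a measure \<Rightarrow> ('a \<Rightarrow> real) \<Rightarrow> ennreal" where
  "p_energy p M f = (\<integral>\<^sup>+x. ennreal (\<bar>f x\<bar> powr p) \<partial>M)"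

lemma sets_gagliardo_measure [measurable_cong]: "sets (gagliardo_measure p s) = sets (borel \<Otimes>\<^sub>M borel)"
proof -
  have "sets (lborel \<Otimes>\<^sub>M lborel :: ('a \<times> 'a) measure) = sets (borel \<Otimes>\<^sub>M borel)"
    by (intro sets_pair_measure_cong) auto
  then show ?thesis by (simp add: gagliardo_measure_def)
qed

lemma nn_integral_gagliardo_measure:
  fixes g :: "'a::euclidean_space \<times> 'a \<Rightarrow> ennreal"
  assumes [measurable]: "g \<in> borel_measurable (borel \<Otimes>\<^sub>M borel)"
  shows "(\<integral>\<^sup>+z. g z \<partial>gagliardo_measure p s) =
    (\<integral>\<^sup>+(x, y). ennreal (1 / norm (x - y) powr (real DIM('a) + s * p)) * g (x, y) \<partial>(lborel \<Otimes>\<^sub>M lborel))"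
  unfolding gagliardo_measure_def by (subst nn_integral_density) (auto simp: split_beta')

lemma J_energy_eq_p_energy:
  fixes u :: "'a::euclidean_space \<Rightarrow> real"
  assumes [measurable]: "u \<in> borel_measurable borel"
  shows "J_energy p s u = ennreal (1 / p) * p_energy p (gagliardo_measure p s) (\<lambda>(x, y). u x - u y)"
  unfolding J_energy_def p_energy_def
  by (subst nn_integral_gagliardo_measure)
    (auto simp: case_prod_beta ennreal_mult'[symmetric] intro!: arg_cong2[where f = "(*)"] nn_integral_cong)

text \<open>The increment vanishes unless x or y lies in the compact support K. In either case
  translation reduces the inner integral to the finite kernel integral I, leaving the volume of K
  times I.\<close>

lemma test_functions_p_energy_finite:
  fixes \<phi> :: "'a::euclidean_space \<Rightarrow> real"
  assumes \<phi>: "\<phi> \<in> test_functions \<Omega>" and s: "0 < s" "s < 1" and p: "0 < p"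
  shows "p_energy p (gagliardo_measure p s) (\<lambda>(x, y). \<phi> x - \<phi> y) < \<infinity>"
proof -
  note [measurable] = test_functions_borel[OF \<phi>]
  define K where "K = closure {x. \<phi> x \<noteq> 0}"
  have "compact K" using \<phi> by (simp add: test_functions_def K_def)
  have [measurable]: "K \<in> sets borel" by (simp add: K_def)
  have zero: "\<phi> x = 0" if "x \<notin> K" for x
    using closure_subset[of "{x. \<phi> x \<noteq> 0}"] that by (auto simp: K_def)
  obtain L where L: "L \<ge> 0" "\<And>x y. \<bar>\<phi> x - \<phi> y\<bar> \<le> L * min 1 (norm (x - y))"
    using test_functions_lipschitz[OF \<phi>] by blast
  define f where "f z = ennreal (min 1 (norm z) powr p / norm z powr (real DIM('a) + s * p))" for z :: 'a
  have [measurable]: "f \<in> borel_measurable borel"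
    unfolding f_def by measurable
  define I where "I = (\<integral>\<^sup>+z. f z \<partial>lborel)"
  have "I < \<infinity>"
    unfolding I_def f_def by (intro nn_integral_kernel_finite s p)
  have bound: "ennreal (1 / norm (x - y) powr (real DIM('a) + s * p)) * ennreal (\<bar>\<phi> x - \<phi> y\<bar> powr p) \<le>
      ennreal (L powr p) * (indicator K x * f (y - x)) + ennreal (L powr p) * (indicator K y * f (x - y))" for x y
  proof (cases "x \<in> K \<or> y \<in> K")
    case True
    have "\<bar>\<phi> x - \<phi> y\<bar> powr p \<le> (L * min 1 (norm (x - y))) powr p"
      using L p by (intro powr_mono2) auto
    also have "\<dots> = L powr p * min 1 (norm (x - y)) powr p"
      using L by (simp add: powr_mult)
    finally have "ennreal (1 / norm (x - y) powr (real DIM('a) + s * p)) * ennreal (\<bar>\<phi> x - \<phi> y\<bar> powr p)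
      \<le> ennreal (1 / norm (x - y) powr (real DIM('a) + s * p)) * ennreal (L powr p * min 1 (norm (x - y)) powr p)"
      by (intro mult_left_mono ennreal_leI) auto
    also have "\<dots> = ennreal (L powr p) * f (x - y)"
      by (simp add: f_def ennreal_mult[symmetric] field_simps)
    also have "\<dots> \<le> ennreal (L powr p) * (indicator K x * f (y - x)) + ennreal (L powr p) * (indicator K y * f (x - y))"
      using True by (auto simp: f_def norm_minus_commute add_increasing add_increasing2)
    finally show ?thesis .
  next
    case False
    then show ?thesis using zero by simp
  qed
  have emK: "emeasure lborel K < \<infinity>"
    using emeasure_compact_finite[OF \<open>compact K\<close>] by simp
  have half1: "(\<integral>\<^sup>+(x, y). indicator K x * f (y - x) \<partial>(lborel \<Otimes>\<^sub>M lborel)) = emeasure lborel K * I"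
  proof -
    have "(\<integral>\<^sup>+(x, y). indicator K x * f (y - x) \<partial>(lborel \<Otimes>\<^sub>M lborel)) =
      (\<integral>\<^sup>+x. \<integral>\<^sup>+y. indicator K x * f (y - x) \<partial>lborel \<partial>lborel)"
      by (subst lborel.nn_integral_fst[symmetric]) (auto simp: case_prod_beta)
    also have "\<dots> = (\<integral>\<^sup>+x. indicator K x * I \<partial>lborel)"
      by (simp add: nn_integral_cmult nn_integral_lborel_translate I_def)
    also have "\<dots> = emeasure lborel K * I"
      by (simp add: nn_integral_multc)
    finally show ?thesis .
  qed
  have half2: "(\<integral>\<^sup>+(x, y). indicator K y * f (x - y) \<partial>(lborel \<Otimes>\<^sub>M lborel)) = emeasure lborel K * I"
  proof -
    have "(\<integral>\<^sup>+(x, y). indicator K y * f (x - y) \<partial>(lborel \<Otimes>\<^sub>M lborel)) =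
      (\<integral>\<^sup>+y. \<integral>\<^sup>+x. indicator K y * f (x - y) \<partial>lborel \<partial>lborel)"
      by (subst lborel_pair.nn_integral_snd[symmetric]) (auto simp: case_prod_beta)
    also have "\<dots> = (\<integral>\<^sup>+y. indicator K y * I \<partial>lborel)"
      by (simp add: nn_integral_cmult nn_integral_lborel_translate I_def)
    also have "\<dots> = emeasure lborel K * I"
      by (simp add: nn_integral_multc)
    finally show ?thesis .
  qed
  have "p_energy p (gagliardo_measure p s) (\<lambda>(x, y). \<phi> x - \<phi> y) =
    (\<integral>\<^sup>+(x, y). ennreal (1 / norm (x - y) powr (real DIM('a) + s * p)) * ennreal (\<bar>\<phi> x - \<phi> y\<bar> powr p) \<partial>(lborel \<Otimes>\<^sub>M lborel))"
    unfolding p_energy_def by (subst nn_integral_gagliardo_measure) (auto simp: case_prod_beta)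
  also have "\<dots> \<le> (\<integral>\<^sup>+(x, y). ennreal (L powr p) * (indicator K x * f (y - x)) + ennreal (L powr p) * (indicator K y * f (x - y)) \<partial>(lborel \<Otimes>\<^sub>M lborel))"
    using bound by (intro nn_integral_mono) auto
  also have "\<dots> = ennreal (L powr p) * (\<integral>\<^sup>+(x, y). indicator K x * f (y - x) \<partial>(lborel \<Otimes>\<^sub>M lborel)) +
     ennreal (L powr p) * (\<integral>\<^sup>+(x, y). indicator K y * f (x - y) \<partial>(lborel \<Otimes>\<^sub>M lborel))"
    unfolding split_beta' by (simp add: nn_integral_add nn_integral_cmult)
  also have "\<dots> < \<infinity>"
    unfolding half1 half2 using emK \<open>I < \<infinity>\<close>
    by (simp add: ennreal_mult_less_top)
  finally show ?thesis .
qed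

lemma test_functions_Lp_finite:
  fixes \<phi> :: "'a::euclidean_space \<Rightarrow> real"
  assumes \<phi>: "\<phi> \<in> test_functions \<Omega>" and p: "0 < p"
  shows "p_energy p lborel \<phi> < \<infinity>"
proof -
  define K where "K = closure {x. \<phi> x \<noteq> 0}"
  have "compact K" using \<phi> by (simp add: test_functions_def K_def)
  have [measurable]: "K \<in> sets borel" by (simp add: K_def)
  have zero: "\<phi> x = 0" if "x \<notin> K" for x
    using closure_subset[of "{x. \<phi> x \<noteq> 0}"] that by (auto simp: K_def)
  obtain M where M: "M \<ge> 0" "\<And>x. \<bar>\<phi> x\<bar> \<le> M"
    using continuous_compact_support_bounded[OF test_functions_continuous[OF \<phi>] \<open>compact K\<close> zero] by blast
  have "p_energy p lborel \<phi> \<le> (\<integral>\<^sup>+x. ennreal (M powr p) * indicator K x \<partial>lborel)"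
    unfolding p_energy_def
  proof (rule nn_integral_mono)
    fix x
    have "\<bar>\<phi> x\<bar> powr p \<le> M powr p"
      using M p by (intro powr_mono2) auto
    then show "ennreal (\<bar>\<phi> x\<bar> powr p) \<le> ennreal (M powr p) * indicator K x"
    proof (cases "x \<in> K")
      case True
      then show ?thesis using \<open>\<bar>\<phi> x\<bar> powr p \<le> M powr p\<close> by (simp add: ennreal_leI)
    next
      case False
      then show ?thesis by (simp add: zero)
    qed
  qed
  also have "\<dots> < \<infinity>"
    using emeasure_compact_finite[OF \<open>compact K\<close>]
    by (subst nn_integral_cmult_indicator) (simp_all add: ennreal_mult_less_top)
  finally show ?thesis .
qed

section \<open>Convergence in energy\<close>

text \<open>A crude constant, from bounding the sum by twice the maximum; it suffices where only
  finiteness and convergence to 0 are at stake.\<close>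

lemma powr_abs_add_le:
  fixes a b :: real
  assumes "0 < p"
  shows "\<bar>a + b\<bar> powr p \<le> 2 powr p * (\<bar>a\<bar> powr p + \<bar>b\<bar> powr p)"
proof -
  define m where "m = max \<bar>a\<bar> \<bar>b\<bar>"
  have "\<bar>a + b\<bar> powr p \<le> (2 * m) powr p"
    using assms by (intro powr_mono2) (auto simp: m_def)
  also have "\<dots> = 2 powr p * m powr p"
    by (simp add: powr_mult m_def)
  also have "m powr p \<le> \<bar>a\<bar> powr p + \<bar>b\<bar> powr p"
    by (simp add: m_def max_def)
  finally show ?thesis by simp
qed

lemma p_energy_add_le:
  assumes [measurable]: "f \<in> borel_measurable M" "g \<in> borel_measurable M" and "0 < p"
  shows "p_energy p M (\<lambda>x. f x + g x) \<le> ennreal (2 powr p) * (p_energy p M f + p_energy p M g)"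
proof -
  have "p_energy p M (\<lambda>x. f x + g x) \<le> (\<integral>\<^sup>+x. ennreal (2 powr p) * (ennreal (\<bar>f x\<bar> powr p) + ennreal (\<bar>g x\<bar> powr p)) \<partial>M)"
    unfolding p_energy_def
  proof (rule nn_integral_mono)
    fix x
    have "ennreal (\<bar>f x + g x\<bar> powr p) \<le> ennreal (2 powr p * (\<bar>f x\<bar> powr p + \<bar>g x\<bar> powr p))"
      by (intro ennreal_leI powr_abs_add_le assms)
    also have "\<dots> = ennreal (2 powr p) * (ennreal (\<bar>f x\<bar> powr p) + ennreal (\<bar>g x\<bar> powr p))"
      by (simp add: ennreal_mult)
    finally show "ennreal (\<bar>f x + g x\<bar> powr p) \<le> ennreal (2 powr p) * (ennreal (\<bar>f x\<bar> powr p) + ennreal (\<bar>g x\<bar> powr p))" .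
  qed
  also have "\<dots> = ennreal (2 powr p) * (p_energy p M f + p_energy p M g)"
    unfolding p_energy_def by (subst nn_integral_cmult, simp, subst nn_integral_add) simp_all
  finally show ?thesis .
qed

lemma p_energy_cmult:
  assumes [measurable]: "f \<in> borel_measurable M"
  shows "p_energy p M (\<lambda>x. c * f x) = ennreal (\<bar>c\<bar> powr p) * p_energy p M f"
  unfolding p_energy_def
  by (subst nn_integral_cmult[symmetric]) (simp_all add: abs_mult powr_mult ennreal_mult)

lemma p_energy_minus: "p_energy p M (\<lambda>x. - f x) = p_energy p M f"
  by (simp add: p_energy_def)

lemma p_energy_diff_le:
  assumes "f \<in> borel_measurable M" "g \<in> borel_measurable M" and "0 < p"
  shows "p_energy p M (\<lambda>x. f x - g x) \<le> ennreal (2 powr p) * (p_energy p M f + p_energy p M g)"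
  using p_energy_add_le[of f M "\<lambda>x. - g x" p] assms by (simp add: p_energy_minus)

lemma p_energy_tendsto_diff:
  assumes "\<And>n. f n \<in> borel_measurable M" "\<And>n. g n \<in> borel_measurable M" and "0 < p"
    and "(\<lambda>n::nat. p_energy p M (f n)) \<longlonglongrightarrow> 0" "(\<lambda>n. p_energy p M (g n)) \<longlonglongrightarrow> 0"
  shows "(\<lambda>n. p_energy p M (\<lambda>x. f n x - g n x)) \<longlonglongrightarrow> 0"
proof (rule tendsto_sandwich[OF _ _ tendsto_const])
  have "(\<lambda>n. ennreal (2 powr p) * (p_energy p M (f n) + p_energy p M (g n))) \<longlonglongrightarrow> ennreal (2 powr p) * (0 + 0)"
    using assms by (intro ennreal_tendsto_cmult tendsto_add) auto
  then show "(\<lambda>n. ennreal (2 powr p) * (p_energy p M (f n) + p_energy p M (g n))) \<longlonglongrightarrow> 0"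
    by simp
qed (use p_energy_diff_le[OF assms(1-3)] in simp_all)

lemma p_energy_AE_subseq:
  assumes [measurable]: "\<And>n. f n \<in> borel_measurable M" and p: "0 < p"
    and lim: "(\<lambda>n::nat. p_energy p M (f n)) \<longlonglongrightarrow> 0"
  obtains r where "strict_mono r" "AE x in M. (\<lambda>n. f (r n) x) \<longlonglongrightarrow> 0"
proof -
  \<comment> \<open>Early terms may have infinite energy; they are dropped so that the L1
    subsequence theorem applies to the p-th powers.\<close>
  have "\<forall>\<^sub>F n in sequentially. p_energy p M (f n) < top"
    using lim by (rule order_tendstoD) simp
  then obtain N where N: "\<And>n. n \<ge> N \<Longrightarrow> p_energy p M (f n) < top"
    by (auto simp: eventually_sequentially)
  have int: "integrable M (\<lambda>x. \<bar>f (n + N) x\<bar> powr p)" for n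
    by (rule integrableI_nonneg) (use N[of "n + N"] in \<open>auto simp: p_energy_def\<close>)
  have eq: "(\<integral>x. norm (\<bar>f (n + N) x\<bar> powr p) \<partial>M) = enn2real (p_energy p M (f (n + N)))" for n
    unfolding p_energy_def by (subst integral_eq_nn_integral) auto
  have "(\<lambda>n. p_energy p M (f (n + N))) \<longlonglongrightarrow> ennreal 0"
    using LIMSEQ_ignore_initial_segment[OF lim, of N] by simp
  then have "(\<lambda>n. (\<integral>x. norm (\<bar>f (n + N) x\<bar> powr p) \<partial>M)) \<longlonglongrightarrow> 0"
    unfolding eq using tendsto_enn2real by fastforce
  then obtain r where r: "strict_mono r" "AE x in M. (\<lambda>n. \<bar>f (r n + N) x\<bar> powr p) \<longlonglongrightarrow> 0"
    using tendsto_L1_AE_subseq[where u = "\<lambda>n x. \<bar>f (n + N) x\<bar> powr p", OF int] by blast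
  show ?thesis
  proof
    show "strict_mono (\<lambda>n. r n + N)"
      using r(1) by (simp add: strict_mono_def)
    show "AE x in M. (\<lambda>n. f (r n + N) x) \<longlonglongrightarrow> 0"
      using r(2)
    proof eventually_elim
      case (elim x)
      have "(\<lambda>n. (\<bar>f (r n + N) x\<bar> powr p) powr (1 / p)) \<longlonglongrightarrow> 0 powr (1 / p)"
        using p by (intro tendsto_powr' elim tendsto_const) auto
      then have "(\<lambda>n. \<bar>f (r n + N) x\<bar>) \<longlonglongrightarrow> 0"
        using p by (simp add: powr_powr)
      then show ?case by (rule tendsto_rabs_zero_cancel)
    qed
  qed
qed

text \<open>The dominating functions may vary along the sequence: subtracting a multiple of
  \<open>\<bar>f n - f\<bar> powr p\<close> leaves a fixed integrable majorant.\<close>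

lemma p_energy_dominated_tendsto:
  assumes [measurable]: "\<And>n. f n \<in> borel_measurable M" "f' \<in> borel_measurable M"
      "\<And>n. b n \<in> borel_measurable M" "b' \<in> borel_measurable M"
    and p: "0 < p"
    and lim: "(\<lambda>n::nat. p_energy p M (\<lambda>x. f n x - f' x)) \<longlonglongrightarrow> 0"
    and fin: "p_energy p M f' < \<infinity>"
    and ae: "AE x in M. (\<lambda>n. b n x) \<longlonglongrightarrow> b' x"
    and le: "\<And>n x. \<bar>b n x\<bar> \<le> \<bar>f n x\<bar>" "\<And>x. \<bar>b' x\<bar> \<le> \<bar>f' x\<bar>"
  shows "(\<lambda>n. p_energy p M (\<lambda>x. b n x - b' x)) \<longlonglongrightarrow> 0"
proof -
  define C where "C = (2::real) powr p"
  have "C \<ge> 0" by (simp add: C_def)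
  \<comment> \<open>After this subtraction the bound below leaves at most \<open>C * C\<close> times
    the p-th power of the fixed function \<open>f'\<close>. Truncation at 0 squeezes
    \<open>h\<close> below the p-th power of \<open>b n - b'\<close>, so pointwise convergence of
    \<open>b n\<close> drives it to 0.\<close>
  define h where "h n x = max 0 (\<bar>b n x - b' x\<bar> powr p - C * \<bar>f n x - f' x\<bar> powr p)" for n x
  have h_meas[measurable]: "h n \<in> borel_measurable M" for n
    unfolding h_def by measurable
  have bound: "\<bar>b n x - b' x\<bar> powr p \<le> C * (\<bar>f n x - f' x\<bar> powr p + C * \<bar>f' x\<bar> powr p)" for n x
  proof -
    have "\<bar>b n x - b' x\<bar> \<le> \<bar>\<bar>f n x - f' x\<bar> + 2 * \<bar>f' x\<bar>\<bar>"
      using le(1)[of n x] le(2)[of x] by linarith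
    then have "\<bar>b n x - b' x\<bar> powr p \<le> \<bar>\<bar>f n x - f' x\<bar> + 2 * \<bar>f' x\<bar>\<bar> powr p"
      using p by (intro powr_mono2) auto
    also have "\<dots> \<le> C * (\<bar>\<bar>f n x - f' x\<bar>\<bar> powr p + \<bar>2 * \<bar>f' x\<bar>\<bar> powr p)"
      unfolding C_def using p by (rule powr_abs_add_le)
    also have "\<dots> = C * (\<bar>f n x - f' x\<bar> powr p + C * \<bar>f' x\<bar> powr p)"
      by (simp add: abs_mult powr_mult C_def)
    finally show ?thesis .
  qed
  have "(\<lambda>n. \<integral>\<^sup>+x. ennreal (h n x) \<partial>M) \<longlonglongrightarrow> (\<integral>\<^sup>+x. 0 \<partial>M)"
  proof (rule nn_integral_dominated_convergence[where w = "\<lambda>x. ennreal (C * C) * ennreal (\<bar>f' x\<bar> powr p)"])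
    show "AE x in M. ennreal (h n x) \<le> ennreal (C * C) * ennreal (\<bar>f' x\<bar> powr p)" for n
    proof (rule AE_I2)
      fix x
      have "h n x \<le> C * C * \<bar>f' x\<bar> powr p"
        using bound[of n x] \<open>C \<ge> 0\<close> by (simp add: h_def algebra_simps)
      then show "ennreal (h n x) \<le> ennreal (C * C) * ennreal (\<bar>f' x\<bar> powr p)"
        using \<open>C \<ge> 0\<close> by (simp add: ennreal_mult[symmetric] ennreal_leI)
    qed
    have "(\<integral>\<^sup>+x. ennreal (C * C) * ennreal (\<bar>f' x\<bar> powr p) \<partial>M) = ennreal (C * C) * p_energy p M f'"
      unfolding p_energy_def by (rule nn_integral_cmult) simp
    then show "(\<integral>\<^sup>+x. ennreal (C * C) * ennreal (\<bar>f' x\<bar> powr p) \<partial>M) < \<infinity>"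
      using fin by (simp add: ennreal_mult_less_top)
    show "AE x in M. (\<lambda>n. ennreal (h n x)) \<longlonglongrightarrow> 0"
      using ae
    proof eventually_elim
      case (elim x)
      have "(\<lambda>n. \<bar>b n x - b' x\<bar> powr p) \<longlonglongrightarrow> \<bar>b' x - b' x\<bar> powr p"
        using p by (intro tendsto_powr' tendsto_intros elim) auto
      then have lim0: "(\<lambda>n. \<bar>b n x - b' x\<bar> powr p) \<longlonglongrightarrow> 0"
        by simp
      have "(\<lambda>n. h n x) \<longlonglongrightarrow> 0"
        by (rule tendsto_sandwich[OF _ _ tendsto_const lim0]) (use \<open>C \<ge> 0\<close> in \<open>auto simp: h_def\<close>)
      then show ?case
        using tendsto_ennrealI by fastforce
    qed
  qed auto
  then have lim_h: "(\<lambda>n. \<integral>\<^sup>+x. ennreal (h n x) \<partial>M) \<longlonglongrightarrow> 0"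
    by simp
  show ?thesis
  proof (rule tendsto_sandwich[OF _ _ tendsto_const])
    have "(\<lambda>n. (\<integral>\<^sup>+x. ennreal (h n x) \<partial>M) + ennreal C * p_energy p M (\<lambda>x. f n x - f' x)) \<longlonglongrightarrow> 0 + ennreal C * 0"
      by (intro tendsto_add lim_h ennreal_tendsto_cmult lim) simp
    then show "(\<lambda>n. (\<integral>\<^sup>+x. ennreal (h n x) \<partial>M) + ennreal C * p_energy p M (\<lambda>x. f n x - f' x)) \<longlonglongrightarrow> 0"
      by simp
    have "p_energy p M (\<lambda>x. b n x - b' x) \<le> (\<integral>\<^sup>+x. ennreal (h n x) \<partial>M) + ennreal C * p_energy p M (\<lambda>x. f n x - f' x)" for n
    proof -
      have "p_energy p M (\<lambda>x. b n x - b' x) \<le> (\<integral>\<^sup>+x. ennreal (h n x) + ennreal C * ennreal (\<bar>f n x - f' x\<bar> powr p) \<partial>M)"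
        unfolding p_energy_def
      proof (rule nn_integral_mono)
        fix x
        have "ennreal (\<bar>b n x - b' x\<bar> powr p) \<le> ennreal (h n x + C * \<bar>f n x - f' x\<bar> powr p)"
          by (intro ennreal_leI) (simp add: h_def)
        also have "\<dots> = ennreal (h n x) + ennreal C * ennreal (\<bar>f n x - f' x\<bar> powr p)"
          using \<open>C \<ge> 0\<close> by (simp add: ennreal_mult h_def)
        finally show "ennreal (\<bar>b n x - b' x\<bar> powr p) \<le> ennreal (h n x) + ennreal C * ennreal (\<bar>f n x - f' x\<bar> powr p)" .
      qed
      also have "\<dots> = (\<integral>\<^sup>+x. ennreal (h n x) \<partial>M) + ennreal C * p_energy p M (\<lambda>x. f n x - f' x)"
        unfolding p_energy_def by (subst nn_integral_add, simp, simp, subst nn_integral_cmult) simp_all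
      finally show ?thesis .
    qed
    then show "\<forall>\<^sub>F n in sequentially. p_energy p M (\<lambda>x. b n x - b' x) \<le>
        (\<integral>\<^sup>+x. ennreal (h n x) \<partial>M) + ennreal C * p_energy p M (\<lambda>x. f n x - f' x)"
      by simp
  qed auto
qed

section \<open>Lattice structure of the Sobolev space\<close>

lemma gagliardo_measurable_diff [measurable]:
  fixes u :: "'a::euclidean_space \<Rightarrow> real"
  assumes [measurable]: "u \<in> borel_measurable borel"
  shows "(\<lambda>(x, y). u x - u y) \<in> borel_measurable (gagliardo_measure p s)"
proof -
  have "(\<lambda>(x, y). u x - u y) \<in> borel_measurable (borel \<Otimes>\<^sub>M borel)"
    by measurable
  then show ?thesis
    by (simp add: measurable_cong_sets[OF sets_gagliardo_measure refl])
qed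

text \<open>The products of a null set with the whole space, on either side, are null for the
  product measure, and passing to a density keeps null sets null.\<close>

lemma gagliardo_AE_pair:
  fixes Q :: "'a::euclidean_space \<Rightarrow> bool"
  assumes "AE x in lborel. Q x"
  shows "AE (x, y) in gagliardo_measure p s. Q x \<and> Q (y :: 'a)"
proof -
  obtain N where N: "N \<in> null_sets lborel" "{x. \<not> Q x} \<subseteq> N"
    using assms by (auto elim!: AE_E3 simp: subset_iff) (metis)
  have [measurable]: "N \<in> sets borel" using N(1) by auto
  have "AE z in lborel \<Otimes>\<^sub>M lborel. fst z \<notin> N \<and> snd z \<notin> N"
  proof (rule lborel_pair.AE_pair_measure)
    show "{z \<in> space (lborel \<Otimes>\<^sub>M lborel :: ('a \<times> 'a) measure). fst z \<notin> N \<and> snd z \<notin> N} \<in> sets (lborel \<Otimes>\<^sub>M lborel)"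
      by measurable
    show "AE x in lborel. AE y in lborel. fst (x, y) \<notin> N \<and> snd (x, y) \<notin> N"
      using AE_not_in[OF N(1)]
    proof eventually_elim
      case (elim x)
      show ?case
        using AE_not_in[OF N(1)] by eventually_elim (use elim in simp)
    qed
  qed
  then have "AE z in lborel \<Otimes>\<^sub>M lborel. Q (fst z) \<and> Q (snd z)"
    by eventually_elim (use N(2) in auto)
  then show ?thesis
    unfolding gagliardo_measure_def by (subst AE_density) (auto simp: case_prod_beta elim: eventually_mono)
qed

lemma p_energy_gagliardo_eq_J_energy:
  assumes "u \<in> borel_measurable borel" "0 < p"
  shows "p_energy p (gagliardo_measure p s) (\<lambda>(x, y). u x - u y) = ennreal p * J_energy p s u"
proof -
  have "ennreal p * (ennreal (1 / p) * X) = X" for X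
    using assms(2) by (simp add: mult.assoc[symmetric] ennreal_mult[symmetric])
  then show ?thesis
    by (simp add: J_energy_eq_p_energy[OF assms(1)])
qed

text \<open>Splits the norm into two energies and writes the nonlocal one as a difference of
  increment functions, the form in which the general energy lemmas apply.\<close>

lemma W0_space_iff:
  fixes \<Omega> :: "'a::euclidean_space set"
  assumes "0 < p"
  shows "u \<in> W0_space p s \<Omega> \<longleftrightarrow> u \<in> borel_measurable borel \<and> (\<forall>x. x \<notin> \<Omega> \<longrightarrow> u x = 0) \<and>
    (\<exists>\<phi>. (\<forall>n. \<phi> n \<in> test_functions \<Omega>) \<and>
      (\<lambda>n::nat. p_energy p (gagliardo_measure p s) (\<lambda>z. (case z of (x, y) \<Rightarrow> \<phi> n x - \<phi> n y) - (case z of (x, y) \<Rightarrow> u x - u y))) \<longlonglongrightarrow> 0 \<and>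
      (\<lambda>n. p_energy p lborel (\<lambda>x. \<phi> n x - u x)) \<longlonglongrightarrow> 0)"
proof -
  have "(\<lambda>n. W_norm_p p s (\<lambda>x. \<phi> n x - u x)) \<longlonglongrightarrow> 0 \<longleftrightarrow>
      (\<lambda>n::nat. p_energy p (gagliardo_measure p s) (\<lambda>z. (case z of (x, y) \<Rightarrow> \<phi> n x - \<phi> n y) - (case z of (x, y) \<Rightarrow> u x - u y))) \<longlonglongrightarrow> 0 \<and>
      (\<lambda>n. p_energy p lborel (\<lambda>x. \<phi> n x - u x)) \<longlonglongrightarrow> 0" (is "?L \<longleftrightarrow> ?R")
    if u: "u \<in> borel_measurable borel" and \<phi>: "\<And>n. \<phi> n \<in> test_functions \<Omega>" for \<phi>
  proof -
    define J where "J n = J_energy p s (\<lambda>x. \<phi> n x - u x)" for n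
    define E where "E n = p_energy p lborel (\<lambda>x. \<phi> n x - u x)" for n
    have J: "p_energy p (gagliardo_measure p s) (\<lambda>z. (case z of (x, y) \<Rightarrow> \<phi> n x - \<phi> n y) - (case z of (x, y) \<Rightarrow> u x - u y))
      = ennreal p * J n" for n
    proof -
      have "p_energy p (gagliardo_measure p s) (\<lambda>z. (case z of (x, y) \<Rightarrow> \<phi> n x - \<phi> n y) - (case z of (x, y) \<Rightarrow> u x - u y))
        = p_energy p (gagliardo_measure p s) (\<lambda>(x, y). (\<phi> n x - u x) - (\<phi> n y - u y))"
        by (intro arg_cong[where f = "p_energy p (gagliardo_measure p s)"]) (auto simp: fun_eq_iff)
      also have "\<dots> = ennreal p * J n"
        unfolding J_def using u test_functions_borel[OF \<phi>] assms
        by (intro p_energy_gagliardo_eq_J_energy borel_measurable_diff) auto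
      finally show ?thesis .
    qed
    have W: "W_norm_p p s (\<lambda>x. \<phi> n x - u x) = J n + E n" for n
      by (simp add: W_norm_p_def J_def E_def p_energy_def)
    have "(\<lambda>n. J n + E n) \<longlonglongrightarrow> 0 \<longleftrightarrow> (\<lambda>n. ennreal p * J n) \<longlonglongrightarrow> 0 \<and> E \<longlonglongrightarrow> 0"
    proof
      assume lim: "(\<lambda>n. J n + E n) \<longlonglongrightarrow> 0"
      have "J \<longlonglongrightarrow> 0" and "E \<longlonglongrightarrow> 0"
        by (rule tendsto_sandwich[OF _ _ tendsto_const lim]; simp)+
      moreover have "(\<lambda>n. ennreal p * J n) \<longlonglongrightarrow> ennreal p * 0"
        using \<open>J \<longlonglongrightarrow> 0\<close> by (intro ennreal_tendsto_cmult) auto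
      ultimately show "(\<lambda>n. ennreal p * J n) \<longlonglongrightarrow> 0 \<and> E \<longlonglongrightarrow> 0"
        by simp
    next
      assume lim: "(\<lambda>n. ennreal p * J n) \<longlonglongrightarrow> 0 \<and> E \<longlonglongrightarrow> 0"
      have "(\<lambda>n. ennreal (1 / p) * (ennreal p * J n)) \<longlonglongrightarrow> ennreal (1 / p) * 0"
        using lim by (intro ennreal_tendsto_cmult) auto
      then have "J \<longlonglongrightarrow> 0"
        using assms by (simp add: mult.assoc[symmetric] ennreal_mult[symmetric])
      then have "(\<lambda>n. J n + E n) \<longlonglongrightarrow> 0 + 0"
        using lim by (intro tendsto_add) auto
      then show "(\<lambda>n. J n + E n) \<longlonglongrightarrow> 0"
        by simp
    qed
    then show ?thesis
      by (simp only: J W E_def[abs_def])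
  qed
  then show ?thesis
    unfolding W0_space_def mem_Collect_eq by blast
qed

lemma W0_space_borel [measurable_dest]: "u \<in> W0_space p s \<Omega> \<Longrightarrow> u \<in> borel_measurable borel"
  by (simp add: W0_space_def)

lemma W0_space_outside: "u \<in> W0_space p s \<Omega> \<Longrightarrow> x \<notin> \<Omega> \<Longrightarrow> u x = 0"
  by (simp add: W0_space_def)

text \<open>An element differs from some test function by finite energy, and test functions have
  finite energy.\<close>

lemma W0_space_finite:
  fixes \<Omega> :: "'a::euclidean_space set"
  assumes u: "u \<in> W0_space p s \<Omega>" and s: "0 < s" "s < 1" and p: "0 < p"
  shows "p_energy p (gagliardo_measure p s) (\<lambda>(x, y). u x - u y) < \<infinity>"
    and "p_energy p lborel u < \<infinity>"
proof -
  have finite: "p_energy p M f < \<infinity>"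
    if lim: "(\<lambda>n::nat. p_energy p M (\<lambda>x. b n x - f x)) \<longlonglongrightarrow> 0"
      and b: "\<And>n. p_energy p M (b n) < \<infinity>"
      and meas[measurable]: "\<And>n. b n \<in> borel_measurable M" "f \<in> borel_measurable M"
    for M :: "'b measure" and b f
  proof -
    have "\<forall>\<^sub>F n in sequentially. p_energy p M (\<lambda>x. b n x - f x) < top"
      using lim by (rule order_tendstoD) simp
    then obtain n where n: "p_energy p M (\<lambda>x. b n x - f x) < top"
      by (auto simp: eventually_sequentially)
    have "p_energy p M f = p_energy p M (\<lambda>x. b n x - (b n x - f x))"
      by simp
    also have "\<dots> \<le> ennreal (2 powr p) * (p_energy p M (b n) + p_energy p M (\<lambda>x. b n x - f x))"
      using p by (intro p_energy_diff_le) auto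
    also have "\<dots> < \<infinity>"
      using n b[of n] by (simp add: ennreal_mult_less_top)
    finally show ?thesis .
  qed
  obtain \<phi> where \<phi>: "\<And>n. \<phi> n \<in> test_functions \<Omega>" and
      J: "(\<lambda>n::nat. p_energy p (gagliardo_measure p s) (\<lambda>z. (case z of (x, y) \<Rightarrow> \<phi> n x - \<phi> n y) - (case z of (x, y) \<Rightarrow> u x - u y))) \<longlonglongrightarrow> 0"
      and E: "(\<lambda>n. p_energy p lborel (\<lambda>x. \<phi> n x - u x)) \<longlonglongrightarrow> 0"
    using u W0_space_iff[OF p] by blast
  note [measurable] = W0_space_borel[OF u] test_functions_borel[OF \<phi>]
  show "p_energy p (gagliardo_measure p s) (\<lambda>(x, y). u x - u y) < \<infinity>"
    using test_functions_p_energy_finite[OF \<phi> s p] by (intro finite[OF J]) (auto intro: gagliardo_measurable_diff)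
  show "p_energy p lborel u < \<infinity>"
    using test_functions_Lp_finite[OF \<phi> p] by (intro finite[OF E]) auto
qed

lemma W0_space_diff:
  fixes \<Omega> :: "'a::euclidean_space set"
  assumes u: "u \<in> W0_space p s \<Omega>" and v: "v \<in> W0_space p s \<Omega>" and p: "0 < p"
  shows "(\<lambda>x. u x - v x) \<in> W0_space p s \<Omega>"
proof -
  obtain \<phi> where \<phi>: "\<And>n. \<phi> n \<in> test_functions \<Omega>" and
      J1: "(\<lambda>n::nat. p_energy p (gagliardo_measure p s) (\<lambda>z. (case z of (x, y) \<Rightarrow> \<phi> n x - \<phi> n y) - (case z of (x, y) \<Rightarrow> u x - u y))) \<longlonglongrightarrow> 0"
      and E1: "(\<lambda>n. p_energy p lborel (\<lambda>x. \<phi> n x - u x)) \<longlonglongrightarrow> 0"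
    using u W0_space_iff[OF p] by blast
  obtain \<psi> where \<psi>: "\<And>n. \<psi> n \<in> test_functions \<Omega>" and
      J2: "(\<lambda>n::nat. p_energy p (gagliardo_measure p s) (\<lambda>z. (case z of (x, y) \<Rightarrow> \<psi> n x - \<psi> n y) - (case z of (x, y) \<Rightarrow> v x - v y))) \<longlonglongrightarrow> 0"
      and E2: "(\<lambda>n. p_energy p lborel (\<lambda>x. \<psi> n x - v x)) \<longlonglongrightarrow> 0"
    using v W0_space_iff[OF p] by blast
  note [measurable] = W0_space_borel[OF u] W0_space_borel[OF v] test_functions_borel[OF \<phi>] test_functions_borel[OF \<psi>]
  have "(\<lambda>n. p_energy p lborel (\<lambda>x. (\<phi> n x - u x) - (\<psi> n x - v x))) \<longlonglongrightarrow> 0"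
    using p by (intro p_energy_tendsto_diff E1 E2) auto
  then have E: "(\<lambda>n. p_energy p lborel (\<lambda>x. (\<phi> n x - \<psi> n x) - (u x - v x))) \<longlonglongrightarrow> 0"
    by (simp add: algebra_simps)
  have "(\<lambda>n. p_energy p (gagliardo_measure p s) (\<lambda>z.
      ((case z of (x, y) \<Rightarrow> \<phi> n x - \<phi> n y) - (case z of (x, y) \<Rightarrow> u x - u y)) -
      ((case z of (x, y) \<Rightarrow> \<psi> n x - \<psi> n y) - (case z of (x, y) \<Rightarrow> v x - v y)))) \<longlonglongrightarrow> 0"
    using p by (intro p_energy_tendsto_diff J1 J2 borel_measurable_diff gagliardo_measurable_diff) auto
  moreover have "(\<lambda>z. ((case z of (x, y) \<Rightarrow> \<phi> n x - \<phi> n y) - (case z of (x, y) \<Rightarrow> u x - u y)) -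
      ((case z of (x, y) \<Rightarrow> \<psi> n x - \<psi> n y) - (case z of (x, y) \<Rightarrow> v x - v y))) =
      (\<lambda>z. (case z of (x, y) \<Rightarrow> (\<phi> n x - \<psi> n x) - (\<phi> n y - \<psi> n y)) - (case z of (x, y) \<Rightarrow> (u x - v x) - (u y - v y)))" for n
    by (auto simp: fun_eq_iff)
  ultimately have J: "(\<lambda>n. p_energy p (gagliardo_measure p s)
      (\<lambda>z. (case z of (x, y) \<Rightarrow> (\<phi> n x - \<psi> n x) - (\<phi> n y - \<psi> n y)) - (case z of (x, y) \<Rightarrow> (u x - v x) - (u y - v y)))) \<longlonglongrightarrow> 0"
    by simp
  show ?thesis
    unfolding W0_space_iff[OF p] using E J test_functions_diff[OF \<phi> \<psi>] W0_space_outside[OF u] W0_space_outside[OF v]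
    by (intro conjI exI[of _ "\<lambda>n x. \<phi> n x - \<psi> n x"] borel_measurable_diff) auto
qed

lemma W0_space_cmult:
  fixes \<Omega> :: "'a::euclidean_space set"
  assumes u: "u \<in> W0_space p s \<Omega>" and p: "0 < p"
  shows "(\<lambda>x. c * u x) \<in> W0_space p s \<Omega>"
proof -
  obtain \<phi> where \<phi>: "\<And>n. \<phi> n \<in> test_functions \<Omega>" and
      J1: "(\<lambda>n::nat. p_energy p (gagliardo_measure p s) (\<lambda>z. (case z of (x, y) \<Rightarrow> \<phi> n x - \<phi> n y) - (case z of (x, y) \<Rightarrow> u x - u y))) \<longlonglongrightarrow> 0"
      and E1: "(\<lambda>n. p_energy p lborel (\<lambda>x. \<phi> n x - u x)) \<longlonglongrightarrow> 0"
    using u W0_space_iff[OF p] by blast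
  note [measurable] = W0_space_borel[OF u] test_functions_borel[OF \<phi>]
  have scale: "(\<lambda>n::nat. p_energy p M (\<lambda>x. c * f n x)) \<longlonglongrightarrow> 0"
    if "(\<lambda>n. p_energy p M (f n)) \<longlonglongrightarrow> 0" "\<And>n. f n \<in> borel_measurable M" for M :: "'b measure" and f
  proof -
    have "(\<lambda>n. ennreal (\<bar>c\<bar> powr p) * p_energy p M (f n)) \<longlonglongrightarrow> ennreal (\<bar>c\<bar> powr p) * 0"
      by (intro ennreal_tendsto_cmult that) simp
    then show ?thesis using that(2) by (simp add: p_energy_cmult)
  qed
  have "(\<lambda>n. p_energy p lborel (\<lambda>x. c * (\<phi> n x - u x))) \<longlonglongrightarrow> 0"
    by (intro scale E1) auto
  then have E: "(\<lambda>n. p_energy p lborel (\<lambda>x. c * \<phi> n x - c * u x)) \<longlonglongrightarrow> 0"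
    by (simp add: algebra_simps)
  have "(\<lambda>n. p_energy p (gagliardo_measure p s) (\<lambda>z.
      c * ((case z of (x, y) \<Rightarrow> \<phi> n x - \<phi> n y) - (case z of (x, y) \<Rightarrow> u x - u y)))) \<longlonglongrightarrow> 0"
    by (intro scale J1 borel_measurable_diff gagliardo_measurable_diff) auto
  moreover have "(\<lambda>z. c * ((case z of (x, y) \<Rightarrow> \<phi> n x - \<phi> n y) - (case z of (x, y) \<Rightarrow> u x - u y))) =
      (\<lambda>z. (case z of (x, y) \<Rightarrow> c * \<phi> n x - c * \<phi> n y) - (case z of (x, y) \<Rightarrow> c * u x - c * u y))" for n
    by (auto simp: fun_eq_iff algebra_simps)
  ultimately have J: "(\<lambda>n. p_energy p (gagliardo_measure p s)
      (\<lambda>z. (case z of (x, y) \<Rightarrow> c * \<phi> n x - c * \<phi> n y) - (case z of (x, y) \<Rightarrow> c * u x - c * u y))) \<longlonglongrightarrow> 0"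
    by simp
  show ?thesis
    unfolding W0_space_iff[OF p] using E J test_functions_cmult[OF \<phi>] W0_space_outside[OF u]
    by (intro conjI exI[of _ "\<lambda>n x. c * \<phi> n x"]) auto
qed

text \<open>Norm convergence does not pass to positive parts by the Lipschitz bound alone: it
  controls increments of a positive part, but not those of the difference of two positive parts.
  Hence the almost everywhere convergent subsequence and dominated convergence, with the increments
  of the approximants as varying majorants.\<close>

lemma W0_space_pos_part:
  fixes \<Omega> :: "'a::euclidean_space set"
  assumes u: "u \<in> W0_space p s \<Omega>" and s: "0 < s" "s < 1" and p: "0 < p"
  shows "(\<lambda>x. max 0 (u x)) \<in> W0_space p s \<Omega>"
proof -
  obtain \<phi> where \<phi>: "\<And>n. \<phi> n \<in> test_functions \<Omega>" and
      J: "(\<lambda>n::nat. p_energy p (gagliardo_measure p s) (\<lambda>z. (case z of (x, y) \<Rightarrow> \<phi> n x - \<phi> n y) - (case z of (x, y) \<Rightarrow> u x - u y))) \<longlonglongrightarrow> 0"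
      and E: "(\<lambda>n. p_energy p lborel (\<lambda>x. \<phi> n x - u x)) \<longlonglongrightarrow> 0"
    using u W0_space_iff[OF p] by blast
  note [measurable] = W0_space_borel[OF u] test_functions_borel[OF \<phi>]
  obtain r where r: "strict_mono r" "AE x in lborel. (\<lambda>n. \<phi> (r n) x - u x) \<longlonglongrightarrow> 0"
    using p_energy_AE_subseq[OF _ p E] by auto
  \<comment> \<open>The smoothing parameter tends to 0 along the subsequence, so that the
    truncations converge to the positive part itself.\<close>
  define b where "b n x = smooth_pos_part (1 / real (Suc n)) (\<phi> (r n) x)" for n x
  have b: "b n \<in> test_functions \<Omega>" for n
    unfolding b_def by (intro test_functions_smooth_pos_part \<phi>) simp
  note [measurable] = test_functions_borel[OF b]
  have ae: "AE x in lborel. (\<lambda>n. b n x) \<longlonglongrightarrow> max 0 (u x)"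
    using r(2)
  proof eventually_elim
    case (elim x)
    have "(\<lambda>n. \<phi> (r n) x) \<longlonglongrightarrow> u x"
      using elim by (rule LIM_zero_cancel)
    then have "(\<lambda>n. max 0 (\<phi> (r n) x)) \<longlonglongrightarrow> max 0 (u x)"
      by (intro tendsto_intros)
    moreover have "(\<lambda>n. b n x - max 0 (\<phi> (r n) x)) \<longlonglongrightarrow> 0"
    proof (rule Lim_null_comparison)
      show "\<forall>\<^sub>F n in sequentially. norm (b n x - max 0 (\<phi> (r n) x)) \<le> 1 / real (Suc n)"
        unfolding b_def real_norm_def by (intro always_eventually allI smooth_pos_part_approx) simp
    qed (rule LIMSEQ_Suc[OF lim_1_over_n])
    ultimately show ?case
      using tendsto_add by fastforce
  qed
  have sub: "(\<lambda>n. X (r n)) \<longlonglongrightarrow> 0" if "X \<longlonglongrightarrow> 0" for X :: "nat \<Rightarrow> ennreal"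
    using LIMSEQ_subseq_LIMSEQ[OF that r(1)] by (simp add: o_def)
  have "(\<lambda>n. p_energy p lborel (\<lambda>x. b n x - max 0 (u x))) \<longlonglongrightarrow> 0"
  proof (rule p_energy_dominated_tendsto[where f = "\<lambda>n. \<phi> (r n)" and f' = u])
    show "\<bar>b n x\<bar> \<le> \<bar>\<phi> (r n) x\<bar>" for n x
      using smooth_pos_part_lipschitz[of "1 / real (Suc n)" "\<phi> (r n) x" 0]
      by (simp add: b_def smooth_pos_part_zero)
    show "(\<lambda>n. p_energy p lborel (\<lambda>x. \<phi> (r n) x - u x)) \<longlonglongrightarrow> 0"
      by (rule sub[OF E])
  qed (use ae p W0_space_finite[OF u s p] in auto)
  moreover have "(\<lambda>n. p_energy p (gagliardo_measure p s)
      (\<lambda>z. (case z of (x, y) \<Rightarrow> b n x - b n y) - (case z of (x, y) \<Rightarrow> max 0 (u x) - max 0 (u y)))) \<longlonglongrightarrow> 0"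
  proof (rule p_energy_dominated_tendsto[where f = "\<lambda>n (x, y). \<phi> (r n) x - \<phi> (r n) y" and f' = "\<lambda>(x, y). u x - u y"])
    show "(\<lambda>n. p_energy p (gagliardo_measure p s) (\<lambda>z. (case z of (x, y) \<Rightarrow> \<phi> (r n) x - \<phi> (r n) y) - (case z of (x, y) \<Rightarrow> u x - u y))) \<longlonglongrightarrow> 0"
      by (rule sub[OF J])
    show "AE z in gagliardo_measure p s. (\<lambda>n. case z of (x, y) \<Rightarrow> b n x - b n y) \<longlonglongrightarrow> (case z of (x, y) \<Rightarrow> max 0 (u x) - max 0 (u y))"
      using gagliardo_AE_pair[OF ae]
      by eventually_elim (auto intro!: tendsto_diff)
    show "\<bar>case z of (x, y) \<Rightarrow> b n x - b n y\<bar> \<le> \<bar>case z of (x, y) \<Rightarrow> \<phi> (r n) x - \<phi> (r n) y\<bar>" for n z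
      by (auto simp: b_def smooth_pos_part_lipschitz split: prod.split)
    show "\<bar>case z of (x, y) \<Rightarrow> max 0 (u x) - max 0 (u y)\<bar> \<le> \<bar>case z of (x, y) \<Rightarrow> u x - u y\<bar>" for z
      by (auto split: prod.split)
  qed (use p W0_space_finite[OF u s p] in \<open>auto intro!: gagliardo_measurable_diff\<close>)
  ultimately show ?thesis
    unfolding W0_space_iff[OF p] using b W0_space_outside[OF u] by (intro conjI exI[of _ b]) auto
qed

section \<open>T-contraction in \<open>L\<^sup>2\<close>\<close>

lemma abs_powr_mult_mono:
  fixes a b q :: real
  assumes "a \<le> b" "0 \<le> q"
  shows "\<bar>a\<bar> powr q * a \<le> \<bar>b\<bar> powr q * b"
proof -
  have *: "\<bar>c\<bar> powr q * c \<le> \<bar>d\<bar> powr q * d" if "0 \<le> c" "c \<le> d" for c d :: real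
    using that assms(2) by (intro mult_mono powr_mono2) auto
  consider "0 \<le> a" | "a < 0" "0 \<le> b" | "b < 0" by linarith
  then show ?thesis
  proof cases
    case 1
    then show ?thesis using * assms(1) by blast
  next
    case 2
    then have "\<bar>a\<bar> powr q * a \<le> 0" "0 \<le> \<bar>b\<bar> powr q * b"
      by (auto intro: mult_nonneg_nonpos)
    then show ?thesis by linarith
  next
    case 3
    then show ?thesis using *[of "- b" "- a"] assms(1) by simp
  qed
qed

lemma W0_space_energy_integrable:
  fixes \<Omega> :: "'a::euclidean_space set"
  assumes u: "u \<in> W0_space p s \<Omega>" and s: "0 < s" "s < 1" and p: "0 < p"
  shows "integrable (lborel \<Otimes>\<^sub>M lborel)
    (\<lambda>(x, y). \<bar>u x - u y\<bar> powr p / norm (x - y) powr (real DIM('a) + s * p))"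
proof (rule integrableI_nonneg)
  note [measurable] = W0_space_borel[OF u]
  show "(\<lambda>(x, y). \<bar>u x - u y\<bar> powr p / norm (x - y) powr (real DIM('a) + s * p))
      \<in> borel_measurable (lborel \<Otimes>\<^sub>M lborel)"
    by measurable
  have "J_energy p s u < \<infinity>"
    using W0_space_finite(1)[OF u s p] p
    unfolding p_energy_gagliardo_eq_J_energy[OF W0_space_borel[OF u] p]
    by (auto simp: ennreal_mult_less_top)
  moreover have "J_energy p s u = ennreal (1 / p) * (\<integral>\<^sup>+z. ennreal (case z of (x, y) \<Rightarrow>
      \<bar>u x - u y\<bar> powr p / norm (x - y) powr (real DIM('a) + s * p)) \<partial>(lborel \<Otimes>\<^sub>M lborel))"
    unfolding J_energy_def by (simp add: split_beta')
  ultimately show "(\<integral>\<^sup>+z. ennreal (case z of (x, y) \<Rightarrow>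
      \<bar>u x - u y\<bar> powr p / norm (x - y) powr (real DIM('a) + s * p)) \<partial>(lborel \<Otimes>\<^sub>M lborel)) < \<infinity>"
    using p by (auto simp: ennreal_mult_less_top)
qed auto

text \<open>Guards against the default value 0 of the Bochner integral: comparing or subtracting two
  forms is meaningful only for integrable integrands.\<close>

lemma frac_p_form_integrable:
  fixes \<Omega> :: "'a::euclidean_space set"
  assumes u: "u \<in> W0_space p s \<Omega>" and \<phi>: "\<phi> \<in> W0_space p s \<Omega>" and s: "0 < s" "s < 1" and p: "2 < p"
  shows "integrable (lborel \<Otimes>\<^sub>M lborel)
    (\<lambda>(x, y). \<bar>u x - u y\<bar> powr (p - 2) * (u x - u y) * (\<phi> x - \<phi> y) / norm (x - y) powr (real DIM('a) + s * p))"
proof (rule Bochner_Integration.integrable_bound)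
  note [measurable] = W0_space_borel[OF u] W0_space_borel[OF \<phi>]
  show "integrable (lborel \<Otimes>\<^sub>M lborel) (\<lambda>z.
      (case z of (x, y) \<Rightarrow> \<bar>u x - u y\<bar> powr p / norm (x - y) powr (real DIM('a) + s * p)) +
      (case z of (x, y) \<Rightarrow> \<bar>\<phi> x - \<phi> y\<bar> powr p / norm (x - y) powr (real DIM('a) + s * p)))"
    using p by (intro Bochner_Integration.integrable_add W0_space_energy_integrable[OF u s] W0_space_energy_integrable[OF \<phi> s]) auto
  show "(\<lambda>(x, y). \<bar>u x - u y\<bar> powr (p - 2) * (u x - u y) * (\<phi> x - \<phi> y) / norm (x - y) powr (real DIM('a) + s * p))
      \<in> borel_measurable (lborel \<Otimes>\<^sub>M lborel)"
    by measurable
  \<comment> \<open>A crude Young inequality: replacing both factors by their maximum m gives m to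
    the power p, which is one of the two terms on the right.\<close>
  have young: "\<bar>\<bar>a\<bar> powr (p - 2) * a * b\<bar> \<le> \<bar>a\<bar> powr p + \<bar>b\<bar> powr p" for a b :: real
  proof -
    define m where "m = max \<bar>a\<bar> \<bar>b\<bar>"
    have "\<bar>\<bar>a\<bar> powr (p - 2) * a * b\<bar> = \<bar>a\<bar> powr (p - 2) * \<bar>a\<bar> * \<bar>b\<bar>"
      by (simp add: abs_mult)
    also have "\<dots> \<le> m powr (p - 2) * m * m"
      using p by (intro mult_mono powr_mono2) (auto simp: m_def)
    also have "\<dots> = m powr p"
    proof (cases "m = 0")
      case False
      then have "m > 0" by (auto simp: m_def max_def split: if_splits)
      have "m powr p = m powr (p - 2 + 1 + 1)" by simp
      also have "\<dots> = m powr (p - 2) * m * m"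
        using \<open>m > 0\<close> by (simp only: powr_add powr_one)
      finally show ?thesis by simp
    qed simp
    also have "\<dots> \<le> \<bar>a\<bar> powr p + \<bar>b\<bar> powr p"
      by (simp add: m_def max_def)
    finally show ?thesis .
  qed
  show "AE z in lborel \<Otimes>\<^sub>M lborel. norm (case z of (x, y) \<Rightarrow> \<bar>u x - u y\<bar> powr (p - 2) * (u x - u y) * (\<phi> x - \<phi> y) / norm (x - y) powr (real DIM('a) + s * p))
    \<le> norm ((case z of (x, y) \<Rightarrow> \<bar>u x - u y\<bar> powr p / norm (x - y) powr (real DIM('a) + s * p)) +
      (case z of (x, y) \<Rightarrow> \<bar>\<phi> x - \<phi> y\<bar> powr p / norm (x - y) powr (real DIM('a) + s * p)))"
  proof (rule AE_I2)
    fix z :: "'a \<times> 'a"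
    obtain x y where z: "z = (x, y)" by (cases z)
    define k where "k = norm (x - y) powr (real DIM('a) + s * p)"
    have "k \<ge> 0" by (simp add: k_def)
    have "\<bar>\<bar>u x - u y\<bar> powr (p - 2) * (u x - u y) * (\<phi> x - \<phi> y)\<bar> / k \<le> (\<bar>u x - u y\<bar> powr p + \<bar>\<phi> x - \<phi> y\<bar> powr p) / k"
      using young \<open>k \<ge> 0\<close> by (rule divide_right_mono)
    then show "norm (case z of (x, y) \<Rightarrow> \<bar>u x - u y\<bar> powr (p - 2) * (u x - u y) * (\<phi> x - \<phi> y) / norm (x - y) powr (real DIM('a) + s * p))
    \<le> norm ((case z of (x, y) \<Rightarrow> \<bar>u x - u y\<bar> powr p / norm (x - y) powr (real DIM('a) + s * p)) +
      (case z of (x, y) \<Rightarrow> \<bar>\<phi> x - \<phi> y\<bar> powr p / norm (x - y) powr (real DIM('a) + s * p)))"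
      using \<open>k \<ge> 0\<close> unfolding z k_def[symmetric] prod.case real_norm_def
      by (simp only: add_divide_distrib[symmetric] abs_divide abs_of_nonneg[of k]) simp
  qed
qed

text \<open>T-monotonicity: the positive part is a nondecreasing function of \<open>u - v\<close>, so its increments
  have the same sign as those of \<open>u - v\<close>.\<close>

lemma frac_p_form_T_monotone:
  fixes \<Omega> :: "'a::euclidean_space set"
  assumes u: "u \<in> W0_space p s \<Omega>" and v: "v \<in> W0_space p s \<Omega>" and s: "0 < s" "s < 1" and p: "2 < p"
  shows "frac_p_form p s v (\<lambda>x. max 0 (u x - v x)) \<le> frac_p_form p s u (\<lambda>x. max 0 (u x - v x))"
proof -
  define \<phi> where "\<phi> x = max 0 (u x - v x)" for x
  have \<phi>: "\<phi> \<in> W0_space p s \<Omega>"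
    unfolding \<phi>_def[abs_def] using s p by (intro W0_space_pos_part W0_space_diff u v) auto
  have "frac_p_form p s v \<phi> \<le> frac_p_form p s u \<phi>"
    unfolding frac_p_form_def
  proof (rule integral_mono)
    fix z :: "'a \<times> 'a"
    obtain x y where z: "z = (x, y)" by (cases z)
    have "\<bar>v x - v y\<bar> powr (p - 2) * (v x - v y) * (\<phi> x - \<phi> y) \<le> \<bar>u x - u y\<bar> powr (p - 2) * (u x - u y) * (\<phi> x - \<phi> y)"
    proof (cases "v x - v y \<le> u x - u y")
      case True
      then have "\<phi> x - \<phi> y \<ge> 0" by (simp add: \<phi>_def max_def)
      then show ?thesis
        using abs_powr_mult_mono[OF True, of "p - 2"] p by (intro mult_right_mono) auto
    next
      case False
      then have "\<phi> x - \<phi> y \<le> 0" by (simp add: \<phi>_def max_def)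
      then show ?thesis
        using abs_powr_mult_mono[of "u x - u y" "v x - v y" "p - 2"] p False by (intro mult_right_mono_neg) auto
    qed
    then show "(case z of (x, y) \<Rightarrow> \<bar>v x - v y\<bar> powr (p - 2) * (v x - v y) * (\<phi> x - \<phi> y) / norm (x - y) powr (real DIM('a) + s * p))
      \<le> (case z of (x, y) \<Rightarrow> \<bar>u x - u y\<bar> powr (p - 2) * (u x - u y) * (\<phi> x - \<phi> y) / norm (x - y) powr (real DIM('a) + s * p))"
      unfolding z prod.case by (rule divide_right_mono) simp
  qed (use u v \<phi> s p in \<open>auto intro: frac_p_form_integrable\<close>)
  then show ?thesis by (simp add: \<phi>_def[abs_def])
qed

text \<open>Both weak equations are tested with the positive part of u - v. The signs are arranged
  for time derivatives, which are -w and -w'.\<close>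

lemma frac_p_Laplacian_T_accretive:
  fixes \<Omega> :: "'a::euclidean_space set"
  assumes u: "frac_p_Laplacian p s \<Omega> u w" and v: "frac_p_Laplacian p s \<Omega> v w'"
    and sq: "u \<in> square_integrable" "v \<in> square_integrable" and s: "0 < s" "s < 1" and p: "2 < p"
  shows "(LINT x|lborel. max 0 (u x - v x) * (- w x - - w' x)) \<le> 0"
proof -
  define \<phi> where "\<phi> x = max 0 (u x - v x)" for x
  have W0: "u \<in> W0_space p s \<Omega>" "v \<in> W0_space p s \<Omega>"
    using u v by (auto simp: frac_p_Laplacian_def)
  have w: "w \<in> square_integrable" "w' \<in> square_integrable"
    using u v unfolding frac_p_Laplacian_def Lr_space_2_iff by auto
  have \<phi>: "\<phi> \<in> W0_space p s \<Omega>" and \<phi>sq: "\<phi> \<in> square_integrable"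
    unfolding \<phi>_def[abs_def] using s p sq
    by (auto intro!: W0_space_pos_part W0_space_diff W0 square_integrable_intros)
  \<comment> \<open>The weak formulation integrates over \<Omega>, the L2 estimates over the whole
    space; the test function vanishes outside \<Omega>.\<close>
  have pairing: "(LINT x:\<Omega>|lborel. f x * \<phi> x) = (LINT x|lborel. f x * \<phi> x)" for f
    unfolding set_lebesgue_integral_def
    by (rule Bochner_Integration.integral_cong) (auto simp: W0_space_outside[OF \<phi>] indicator_def)
  have "(LINT x|lborel. \<phi> x * (- w x - - w' x)) = (LINT x|lborel. w' x * \<phi> x - w x * \<phi> x)"
    by (simp add: algebra_simps)
  also have "\<dots> = frac_p_form p s v \<phi> - frac_p_form p s u \<phi>"
    using u v \<phi> w \<phi>sq by (simp add: square_integrable_mult frac_p_Laplacian_def pairing)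
  also have "\<dots> \<le> 0"
    using frac_p_form_T_monotone[OF W0 s p] by (simp add: \<phi>_def[abs_def])
  finally show ?thesis by (simp add: \<phi>_def)
qed

section \<open>Differences of curves and the contraction for two solutions\<close>

lemma has_L2_time_derivative_diff:
  fixes X Y :: "real \<Rightarrow> 'a::euclidean_space \<Rightarrow> real"
  assumes X: "\<And>s. s > 0 \<Longrightarrow> X s \<in> square_integrable" and Y: "\<And>s. s > 0 \<Longrightarrow> Y s \<in> square_integrable"
    and D: "D \<in> square_integrable" "D' \<in> square_integrable" and "t > 0"
    and dX: "has_L2_time_derivative X D t" and dY: "has_L2_time_derivative Y D' t"
  shows "has_L2_time_derivative (\<lambda>s x. X s x - Y s x) (\<lambda>x. D x - D' x) t"
  unfolding has_L2_time_derivative_def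
proof (rule tendsto_sandwich[OF _ _ tendsto_const])
  define R where "R h x = (X (t + h) x - X t x) / h - D x" for h x
  define R' where "R' h x = (Y (t + h) x - Y t x) / h - D' x" for h x
  have "((\<lambda>h. L2_norm (R h) + L2_norm (R' h)) \<longlongrightarrow> 0 + 0) (at 0)"
    using dX dY unfolding has_L2_time_derivative_def R_def R'_def by (rule tendsto_add)
  then show "((\<lambda>h. L2_norm (R h) + L2_norm (R' h)) \<longlongrightarrow> 0) (at 0)"
    by simp
  have "((\<lambda>h. t + h) \<longlongrightarrow> t + 0) (at 0)" by (intro tendsto_intros)
  then have "\<forall>\<^sub>F h in at 0. t + h > 0"
    using \<open>t > 0\<close> by (intro order_tendstoD) auto
  then show "\<forall>\<^sub>F h in at 0. L2_norm (\<lambda>x. (X (t + h) x - Y (t + h) x - (X t x - Y t x)) / h - (D x - D' x))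
      \<le> L2_norm (R h) + L2_norm (R' h)"
  proof eventually_elim
    case (elim h)
    have "R h \<in> square_integrable" "R' h \<in> square_integrable"
      unfolding R_def[abs_def] R'_def[abs_def] using X Y D elim \<open>t > 0\<close>
      by (auto intro!: square_integrable_intros)
    then have "L2_norm (\<lambda>x. R h x - R' h x) \<le> L2_norm (R h) + L2_norm (R' h)"
      by (rule L2_norm_triangle_diff)
    moreover have "(\<lambda>x. R h x - R' h x) =
        (\<lambda>x. (X (t + h) x - Y (t + h) x - (X t x - Y t x)) / h - (D x - D' x))"
      by (simp add: fun_eq_iff R_def R'_def diff_divide_distrib)
    ultimately show ?case by simp
  qed
qed (simp add: L2_norm_nonneg)

lemma L2_absolutely_continuous_diff:
  assumes X: "\<And>t. \<alpha> \<le> t \<Longrightarrow> X t \<in> square_integrable" and Y: "\<And>t. \<alpha> \<le> t \<Longrightarrow> Y t \<in> square_integrable"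
    and acX: "L2_absolutely_continuous \<alpha> \<beta> X" and acY: "L2_absolutely_continuous \<alpha> \<beta> Y"
  shows "L2_absolutely_continuous \<alpha> \<beta> (\<lambda>t x. X t x - Y t x)"
  unfolding L2_absolutely_continuous_def
proof (intro allI impI)
  fix \<epsilon> :: real assume "\<epsilon> > 0"
  then have "\<epsilon> / 2 > 0" by simp
  obtain \<delta>1 where "\<delta>1 > 0" and \<delta>1: "\<And>(n::nat) a b.
        (\<forall>i<n. \<alpha> \<le> a i \<and> a i \<le> b i \<and> b i \<le> \<beta>) \<and> (\<forall>j<n. \<forall>i<j. b i \<le> a j) \<and>
        (\<Sum>i<n. b i - a i) < \<delta>1 \<Longrightarrow> (\<Sum>i<n. L2_norm (\<lambda>x. X (b i) x - X (a i) x)) < \<epsilon> / 2"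
    using acX \<open>\<epsilon> / 2 > 0\<close> unfolding L2_absolutely_continuous_def by blast
  obtain \<delta>2 where "\<delta>2 > 0" and \<delta>2: "\<And>(n::nat) a b.
        (\<forall>i<n. \<alpha> \<le> a i \<and> a i \<le> b i \<and> b i \<le> \<beta>) \<and> (\<forall>j<n. \<forall>i<j. b i \<le> a j) \<and>
        (\<Sum>i<n. b i - a i) < \<delta>2 \<Longrightarrow> (\<Sum>i<n. L2_norm (\<lambda>x. Y (b i) x - Y (a i) x)) < \<epsilon> / 2"
    using acY \<open>\<epsilon> / 2 > 0\<close> unfolding L2_absolutely_continuous_def by blast
  have "(\<Sum>i<n. L2_norm (\<lambda>x. X (b i) x - Y (b i) x - (X (a i) x - Y (a i) x))) < \<epsilon>"
    if ab: "(\<forall>i<n. \<alpha> \<le> a i \<and> a i \<le> b i \<and> b i \<le> \<beta>) \<and> (\<forall>j<n. \<forall>i<j. b i \<le> a j) \<and>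
        (\<Sum>i<n. b i - a i) < min \<delta>1 \<delta>2" for n :: nat and a b
  proof -
    have "(\<Sum>i<n. L2_norm (\<lambda>x. X (b i) x - Y (b i) x - (X (a i) x - Y (a i) x))) \<le>
      (\<Sum>i<n. L2_norm (\<lambda>x. X (b i) x - X (a i) x) + L2_norm (\<lambda>x. Y (b i) x - Y (a i) x))"
    proof (rule sum_mono)
      fix i assume "i \<in> {..<n}"
      then have i: "\<alpha> \<le> a i" "\<alpha> \<le> b i" using ab by force+
      have "L2_norm (\<lambda>x. (X (b i) x - X (a i) x) - (Y (b i) x - Y (a i) x)) \<le>
        L2_norm (\<lambda>x. X (b i) x - X (a i) x) + L2_norm (\<lambda>x. Y (b i) x - Y (a i) x)"
        using i by (intro L2_norm_triangle_diff square_integrable_diff X Y)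
      then show "L2_norm (\<lambda>x. X (b i) x - Y (b i) x - (X (a i) x - Y (a i) x)) \<le>
        L2_norm (\<lambda>x. X (b i) x - X (a i) x) + L2_norm (\<lambda>x. Y (b i) x - Y (a i) x)"
        by (simp add: algebra_simps)
    qed
    also have "\<dots> < \<epsilon>"
      using \<delta>1[of n a b] \<delta>2[of n a b] ab by (simp add: sum.distrib)
    finally show ?thesis .
  qed
  then show "\<exists>\<delta>>0. \<forall>(n::nat) a b.
        (\<forall>i<n. \<alpha> \<le> a i \<and> a i \<le> b i \<and> b i \<le> \<beta>) \<and> (\<forall>j<n. \<forall>i<j. b i \<le> a j) \<and>
        (\<Sum>i<n. b i - a i) < \<delta> \<longrightarrow>
        (\<Sum>i<n. L2_norm (\<lambda>x. X (b i) x - Y (b i) x - (X (a i) x - Y (a i) x))) < \<epsilon>"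
    using \<open>\<delta>1 > 0\<close> \<open>\<delta>2 > 0\<close> by (intro exI[of _ "min \<delta>1 \<delta>2"]) auto
qed

lemma solves_equation_T_contraction:
  fixes \<Omega> :: "'a::euclidean_space set"
  assumes s: "0 < s" "s < 1" and p: "2 < p"
    and u: "solves_equation p s \<Omega> u" and v: "solves_equation p s \<Omega> v"
    and init: "u 0 \<in> square_integrable" "v 0 \<in> square_integrable"
    and cont: "((\<lambda>t. L2_norm (\<lambda>x. u t x - u 0 x)) \<longlongrightarrow> 0) (at_right 0)"
      "((\<lambda>t. L2_norm (\<lambda>x. v t x - v 0 x)) \<longlongrightarrow> 0) (at_right 0)"
    and "t > 0"
  shows "L2_norm (\<lambda>x. max 0 (u t x - v t x)) \<le> L2_norm (\<lambda>x. max 0 (u 0 x - v 0 x))"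
proof -
  \<comment> \<open>\<open>solves_equation\<close> speaks of positive times only; membership at time
    0 comes from \<open>init\<close>.\<close>
  have sq: "u t \<in> square_integrable" "v t \<in> square_integrable" if "t \<ge> 0" for t
    using u v init that unfolding solves_equation_def Lr_space_2_iff by (cases "t = 0"; auto)+
  obtain w where w: "\<And>t. t > 0 \<Longrightarrow> frac_p_Laplacian p s \<Omega> (u t) (w t)"
    "AE t in lborel. t > 0 \<longrightarrow> has_L2_time_derivative u (\<lambda>x. - w t x) t"
    using u by (auto simp: solves_equation_def)
  obtain w' where w': "\<And>t. t > 0 \<Longrightarrow> frac_p_Laplacian p s \<Omega> (v t) (w' t)"
    "AE t in lborel. t > 0 \<longrightarrow> has_L2_time_derivative v (\<lambda>x. - w' t x) t"
    using v by (auto simp: solves_equation_def)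
  have wsq: "(\<lambda>x. - w t x) \<in> square_integrable" "(\<lambda>x. - w' t x) \<in> square_integrable" if "t > 0" for t
    using w(1)[OF that] w'(1)[OF that] square_integrable_cmult[of "w t" "-1"] square_integrable_cmult[of "w' t" "-1"]
    unfolding frac_p_Laplacian_def Lr_space_2_iff by auto
  show ?thesis
  proof (rule pos_part_energy_le_initial[OF _ _ _ _ \<open>t > 0\<close>, of "\<lambda>t x. u t x - v t x"])
    show "(\<lambda>x. u t x - v t x) \<in> square_integrable" if "t \<ge> 0" for t
      using sq[OF that] by (rule square_integrable_diff)
    show "L2_absolutely_continuous \<alpha> \<beta> (\<lambda>t x. u t x - v t x)" if "0 < \<alpha>" "\<alpha> < \<beta>" for \<alpha> \<beta>
      using sq u v that by (intro L2_absolutely_continuous_diff) (auto simp: solves_equation_def)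
    show "AE t in lborel. t > 0 \<longrightarrow> (\<exists>D\<in>square_integrable. has_L2_time_derivative (\<lambda>t x. u t x - v t x) D t \<and>
      (LINT x|lborel. max 0 (u t x - v t x) * D x) \<le> 0)"
      using w(2) w'(2)
    proof eventually_elim
      case (elim t)
      show ?case
      proof
        assume "t > 0"
        then show "\<exists>D\<in>square_integrable. has_L2_time_derivative (\<lambda>t x. u t x - v t x) D t \<and>
          (LINT x|lborel. max 0 (u t x - v t x) * D x) \<le> 0"
          using elim sq wsq[of t] w(1)[of t] w'(1)[of t] s p
          by (intro bexI[of _ "\<lambda>x. - w t x - - w' t x"] conjI has_L2_time_derivative_diff
              frac_p_Laplacian_T_accretive square_integrable_diff) auto
      qed
    qed
    show "((\<lambda>t. L2_norm (\<lambda>x. u t x - v t x - (u 0 x - v 0 x))) \<longlongrightarrow> 0) (at_right 0)"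
    proof (rule tendsto_sandwich[OF _ _ tendsto_const])
      show "((\<lambda>t. L2_norm (\<lambda>x. u t x - u 0 x) + L2_norm (\<lambda>x. v t x - v 0 x)) \<longlongrightarrow> 0) (at_right 0)"
        using tendsto_add[OF cont] by simp
      have "\<forall>\<^sub>F t in at_right 0. t > (0::real)"
        by (simp add: eventually_at_filter)
      then show "\<forall>\<^sub>F t in at_right 0. L2_norm (\<lambda>x. u t x - v t x - (u 0 x - v 0 x)) \<le>
          L2_norm (\<lambda>x. u t x - u 0 x) + L2_norm (\<lambda>x. v t x - v 0 x)"
      proof eventually_elim
        case (elim t)
        have "L2_norm (\<lambda>x. (u t x - u 0 x) - (v t x - v 0 x)) \<le>
          L2_norm (\<lambda>x. u t x - u 0 x) + L2_norm (\<lambda>x. v t x - v 0 x)"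
          using elim by (intro L2_norm_triangle_diff square_integrable_diff sq) auto
        then show ?case by (simp add: algebra_simps)
      qed
    qed (simp add: L2_norm_nonneg)
  qed
qed

section \<open>The separable solution as an upper barrier\<close>

text \<open>The operator is homogeneous of degree p - 1 on positive multiples. This reduces the
  equation for a separable function to an ordinary differential equation for its time
  factor.\<close>

lemma frac_p_Laplacian_cmult:
  fixes \<Omega> :: "'a::euclidean_space set"
  assumes L: "frac_p_Laplacian p s \<Omega> u w" and p: "2 < p" and "0 < c"
  shows "frac_p_Laplacian p s \<Omega> (\<lambda>x. c * u x) (\<lambda>x. c powr (p - 1) * w x)"
  unfolding frac_p_Laplacian_def
proof (intro conjI ballI)
  have u: "u \<in> W0_space p s \<Omega>" and w: "w \<in> Lr_space 2 \<Omega>"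
    using L by (auto simp only: frac_p_Laplacian_def)
  show "(\<lambda>x. c * u x) \<in> W0_space p s \<Omega>"
    using u p by (intro W0_space_cmult) auto
  show "(\<lambda>x. c powr (p - 1) * w x) \<in> Lr_space 2 \<Omega>"
    using w unfolding Lr_space_2_iff by (auto intro: square_integrable_cmult)
  fix \<phi> assume \<phi>: "\<phi> \<in> W0_space p s \<Omega>"
  have c: "c powr (p - 1) = c powr (p - 2) * c"
  proof -
    have "c powr (p - 1) = c powr (p - 2 + 1)" by simp
    also have "\<dots> = c powr (p - 2) * c"
      using \<open>0 < c\<close> by (simp only: powr_add powr_one)
    finally show ?thesis .
  qed
  have "\<bar>c * a - c * b\<bar> powr (p - 2) * (c * a - c * b) = c powr (p - 1) * (\<bar>a - b\<bar> powr (p - 2) * (a - b))" for a b :: real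
  proof -
    have "\<bar>c * a - c * b\<bar> = c * \<bar>a - b\<bar>"
      using \<open>0 < c\<close> by (simp add: right_diff_distrib[symmetric] abs_mult)
    then show ?thesis
      using \<open>0 < c\<close> by (simp add: c powr_mult algebra_simps)
  qed
  then have "frac_p_form p s (\<lambda>x. c * u x) \<phi> =
    (LINT z|(lborel \<Otimes>\<^sub>M lborel). c powr (p - 1) * (case z of (x, y) \<Rightarrow>
        \<bar>u x - u y\<bar> powr (p - 2) * (u x - u y) * (\<phi> x - \<phi> y) / norm (x - y) powr (real DIM('a) + s * p)))"
    unfolding frac_p_form_def by (intro Bochner_Integration.integral_cong) (auto simp: mult.assoc)
  also have "\<dots> = c powr (p - 1) * frac_p_form p s u \<phi>"
    unfolding frac_p_form_def by (rule integral_mult_right_zero)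
  also have "frac_p_form p s u \<phi> = (LINT x:\<Omega>|lborel. w x * \<phi> x)"
    using L \<phi> by (simp add: frac_p_Laplacian_def)
  also have "c powr (p - 1) * \<dots> = (LINT x:\<Omega>|lborel. c powr (p - 1) * w x * \<phi> x)"
    by (simp add: mult.assoc)
  finally show "frac_p_form p s (\<lambda>x. c * u x) \<phi> = (LINT x:\<Omega>|lborel. c powr (p - 1) * w x * \<phi> x)" .
qed

text \<open>Membership in L2 is read off from the right-hand side of the eigenvalue equation, which
  \<open>frac_p_Laplacian\<close> requires to lie in L2.\<close>

lemma eigenfunction_square_integrable:
  assumes L: "frac_p_Laplacian p s \<Omega> F (\<lambda>x. 1 / (p - 2) * F x)" and p: "2 < p"
  shows "F \<in> square_integrable"
proof -
  have "(\<lambda>x. 1 / (p - 2) * F x) \<in> square_integrable"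
    using L unfolding frac_p_Laplacian_def Lr_space_2_iff by blast
  from square_integrable_cmult[OF this, of "p - 2"] show ?thesis
    using p by simp
qed

text \<open>The time factor c satisfies c' = -c^(p-1) / (p-2): multiplying the exponent -1/(p-2) by
  p - 1 is the same as lowering it by 1.\<close>

lemma separable_coefficient_has_derivative:
  fixes t e p :: real
  assumes "2 < p" "t + e > 0"
  shows "((\<lambda>t. (t + e) powr (- 1 / (p - 2))) has_real_derivative
    - (1 / (p - 2) * ((t + e) powr (- 1 / (p - 2))) powr (p - 1))) (at t)"
proof -
  have "- 1 / (p - 2) * (p - 1) = - 1 / (p - 2) - 1"
    using assms(1) by (simp add: field_simps)
  moreover have "((\<lambda>t. (t + e) powr (- 1 / (p - 2))) has_real_derivative
      - 1 / (p - 2) * (t + e) powr (- 1 / (p - 2) - 1) * (1 + 0)) (at t)"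
    by (rule DERIV_fun_powr[of "\<lambda>t. t + e" "1 + 0" t "- 1 / (p - 2)", simplified of_nat_1])
      (use assms in \<open>auto intro!: derivative_eq_intros\<close>)
  ultimately show ?thesis
    by (simp only: powr_powr) simp
qed

lemma L2_norm_cmult_diff: "L2_norm (\<lambda>x. a * f x - b * f x) = \<bar>a - b\<bar> * L2_norm f"
  using L2_norm_cmult[of "a - b" f] by (simp add: algebra_simps)

text \<open>The shift covers U itself, with e = 0, as well as the comparison functions with e >
  0.\<close>

lemma solves_equation_separable:
  fixes \<Omega> :: "'a::euclidean_space set"
  assumes p: "2 < p" and L: "frac_p_Laplacian p s \<Omega> F (\<lambda>x. 1 / (p - 2) * F x)" and e: "0 \<le> e"
  shows "solves_equation p s \<Omega> (\<lambda>t. separable_solution p F (t + e))"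
proof -
  define c where "c t = (t + e) powr (- 1 / (p - 2))" for t
  have sep: "separable_solution p F (t + e) = (\<lambda>x. c t * F x)" for t
    by (simp add: separable_solution_def c_def fun_eq_iff)
  define w where "w t x = c t powr (p - 1) * (1 / (p - 2) * F x)" for t x
  have Fsq: "F \<in> square_integrable"
    using L p by (rule eigenfunction_square_integrable)
  have F0: "F x = 0" if "x \<notin> \<Omega>" for x
    using L that by (auto simp: frac_p_Laplacian_def W0_space_outside)
  have c_pos: "c t > 0" if "t > 0" for t
    using that e by (simp add: c_def)
  have c_deriv: "(c has_real_derivative - (1 / (p - 2) * c t powr (p - 1))) (at t)" if "t > 0" for t
    unfolding c_def[abs_def] by (rule separable_coefficient_has_derivative) (use p that e in auto)
  have "L2_absolutely_continuous \<alpha> \<beta> (\<lambda>t x. c t * F x)" if "0 < \<alpha>" "\<alpha> < \<beta>" for \<alpha> \<beta>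
    unfolding L2_absolutely_continuous_def
  proof (intro allI impI)
    fix \<epsilon> :: real assume "\<epsilon> > 0"
    \<comment> \<open>A Lipschitz constant for c to the right of \<alpha>: c decreases, so the
      modulus of its derivative is largest at \<alpha>.\<close>
    define B where "B = 1 / (p - 2) * c \<alpha> powr (p - 1)"
    have "B \<ge> 0" using p by (simp add: B_def)
    have c_mono: "c t \<le> c \<alpha>" if "\<alpha> \<le> t" for t
      unfolding c_def using that \<open>0 < \<alpha>\<close> e p by (intro powr_mono2') auto
    have lip: "\<bar>c b - c a\<bar> \<le> B * (b - a)" if "\<alpha> \<le> a" "a \<le> b" "b \<le> \<beta>" for a b
    proof -
      have "norm (c b - c a) \<le> B * norm (b - a)"
      proof (rule field_differentiable_bound[of "{\<alpha>..\<beta>}" c "\<lambda>t. - (1 / (p - 2) * c t powr (p - 1))"])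
        fix t assume t: "t \<in> {\<alpha>..\<beta>}"
        show "(c has_field_derivative - (1 / (p - 2) * c t powr (p - 1))) (at t within {\<alpha>..\<beta>})"
          using t \<open>0 < \<alpha>\<close> by (intro has_field_derivative_at_within[OF c_deriv]) auto
        have "c t powr (p - 1) \<le> c \<alpha> powr (p - 1)"
          using c_mono[of t] c_pos[of t] t \<open>0 < \<alpha>\<close> p by (intro powr_mono2) auto
        then show "norm (- (1 / (p - 2) * c t powr (p - 1))) \<le> B"
          using p by (simp add: B_def divide_right_mono)
      qed (use that in auto)
      then show ?thesis using that by simp
    qed
    \<comment> \<open>The summand 1 keeps M positive, so that dividing \<epsilon> by it is
      legitimate even if the product is 0.\<close>
    define M where "M = B * L2_norm F + 1"
    have "B * L2_norm F \<ge> 0" using \<open>B \<ge> 0\<close> by (simp add: L2_norm_nonneg)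
    then have "M > 0" by (simp add: M_def)
    have "(\<Sum>i<n. L2_norm (\<lambda>x. c (b i) * F x - c (a i) * F x)) < \<epsilon>"
      if ab: "(\<forall>i<n. \<alpha> \<le> a i \<and> a i \<le> b i \<and> b i \<le> \<beta>) \<and> (\<forall>j<n. \<forall>i<j. b i \<le> a j) \<and>
        (\<Sum>i<n. b i - a i) < \<epsilon> / M" for n :: nat and a b
    proof -
      have "(\<Sum>i<n. L2_norm (\<lambda>x. c (b i) * F x - c (a i) * F x)) \<le> (\<Sum>i<n. M * (b i - a i))"
      proof (rule sum_mono)
        fix i assume "i \<in> {..<n}"
        then have i: "\<alpha> \<le> a i" "a i \<le> b i" "b i \<le> \<beta>" using ab by auto
        have "\<bar>c (b i) - c (a i)\<bar> * L2_norm F \<le> B * (b i - a i) * L2_norm F"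
          using lip[OF i] by (intro mult_right_mono) (auto simp: L2_norm_nonneg)
        also have "\<dots> \<le> M * (b i - a i)"
          using i by (simp add: M_def algebra_simps)
        finally show "L2_norm (\<lambda>x. c (b i) * F x - c (a i) * F x) \<le> M * (b i - a i)"
          by (simp add: L2_norm_cmult_diff)
      qed
      also have "\<dots> = M * (\<Sum>i<n. b i - a i)"
        by (simp add: sum_distrib_left)
      also have "\<dots> < \<epsilon>"
        using ab \<open>M > 0\<close> by (simp add: field_simps)
      finally show ?thesis .
    qed
    then show "\<exists>\<delta>>0. \<forall>(n::nat) a b.
        (\<forall>i<n. \<alpha> \<le> a i \<and> a i \<le> b i \<and> b i \<le> \<beta>) \<and> (\<forall>j<n. \<forall>i<j. b i \<le> a j) \<and>
        (\<Sum>i<n. b i - a i) < \<delta> \<longrightarrow>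
        (\<Sum>i<n. L2_norm (\<lambda>x. c (b i) * F x - c (a i) * F x)) < \<epsilon>"
      using \<open>\<epsilon> > 0\<close> \<open>M > 0\<close> by (intro exI[of _ "\<epsilon> / M"]) auto
  qed
  moreover have "frac_p_Laplacian p s \<Omega> (\<lambda>x. c t * F x) (w t)" if "t > 0" for t
    unfolding w_def[abs_def] using L p c_pos[OF that] by (rule frac_p_Laplacian_cmult)
  moreover have "has_L2_time_derivative (\<lambda>t x. c t * F x) (\<lambda>x. - w t x) t" if "t > 0" for t
    unfolding has_L2_time_derivative_def
  proof -
    define d where "d = - (1 / (p - 2) * c t powr (p - 1))"
    have "((\<lambda>h. (c (t + h) - c t) / h) \<longlongrightarrow> d) (at 0)"
      using c_deriv[OF that] by (simp add: DERIV_def d_def)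
    then have "((\<lambda>h. \<bar>(c (t + h) - c t) / h - d\<bar> * L2_norm F) \<longlongrightarrow> \<bar>d - d\<bar> * L2_norm F) (at 0)"
      by (intro tendsto_intros)
    moreover have "(\<lambda>x. (c (t + h) * F x - c t * F x) / h - - w t x) = (\<lambda>x. ((c (t + h) - c t) / h - d) * F x)" for h
      by (simp add: fun_eq_iff w_def d_def left_diff_distrib diff_divide_distrib distrib_right)
    ultimately show "((\<lambda>h. L2_norm (\<lambda>x. (c (t + h) * F x - c t * F x) / h - - w t x)) \<longlongrightarrow> 0) (at 0)"
      by (simp only: L2_norm_cmult) simp
  qed
  moreover have "(\<lambda>x. c t * F x) \<in> Lr_space 2 \<Omega>" for t
    unfolding Lr_space_2_iff using Fsq F0 by (auto intro: square_integrable_cmult)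
  ultimately show ?thesis
    unfolding solves_equation_def sep by (intro conjI exI[of _ w]) auto
qed

text \<open>Comparison with \<open>U(t + e)\<close>, whose initial datum tends to infinity on \<open>\<Omega>\<close> as
  \<open>e\<close> tends to 0.\<close>

lemma strong_solution_le_separable:
  fixes \<Omega> :: "'a::euclidean_space set"
  assumes s: "0 < s" "s < 1" and p: "2 < p"
    and L: "frac_p_Laplacian p s \<Omega> F (\<lambda>x. 1 / (p - 2) * F x)"
    and pos: "\<And>x. x \<in> \<Omega> \<Longrightarrow> F x > 0"
    and v: "strong_solution p s \<Omega> v0 v" and "t > 0"
  shows "AE x in lborel. v t x \<le> separable_solution p F t x"
proof -
  define k where "k = - 1 / (p - 2)"
  have "k < 0" using p by (simp add: k_def divide_neg_pos)
  have Fsq: "F \<in> square_integrable"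
    using L p by (rule eigenfunction_square_integrable)
  have F0: "F x = 0" if "x \<notin> \<Omega>" for x
    using L that by (auto simp: frac_p_Laplacian_def W0_space_outside)
  have F_nonneg: "F x \<ge> 0" for x
    using pos[of x] F0[of x] by (cases "x \<in> \<Omega>") auto
  have v_L2: "v t \<in> square_integrable" and v_out: "\<And>x. x \<notin> \<Omega> \<Longrightarrow> v t x = 0" if "t \<ge> 0" for t
    using v that unfolding strong_solution_def Lr_space_2_iff by auto
  note [measurable] = square_integrable_borel[OF Fsq] square_integrable_borel[OF v_L2[of 0, simplified]]
  define U where "U e t = separable_solution p F (t + e)" for e t
  have U: "U e t x = (t + e) powr k * F x" for e t x
    by (simp add: U_def separable_solution_def k_def)
  have v_cont: "((\<lambda>t. L2_norm (\<lambda>x. v t x - v 0 x)) \<longlongrightarrow> 0) (at_right 0)"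
  proof (rule tendsto_within_subset)
    show "((\<lambda>t. L2_norm (\<lambda>x. v t x - v 0 x)) \<longlongrightarrow> 0) (at 0 within {0..})"
      using v by (simp add: strong_solution_def)
  qed auto
  \<comment> \<open>At e = 0 the convention \<open>0 powr k = 0\<close> would give the initial value
    0 instead of an infinite one, so the contraction is applied for e > 0 only.\<close>
  have compare: "L2_norm (\<lambda>x. max 0 (v t x - U e t x)) \<le> L2_norm (\<lambda>x. max 0 (v 0 x - U e 0 x))" if "e > 0" for e
  proof (rule solves_equation_T_contraction[OF s p _ _ _ _ v_cont _ \<open>t > 0\<close>])
    show "solves_equation p s \<Omega> v"
      using v by (simp add: strong_solution_def)
    show "solves_equation p s \<Omega> (U e)"
      unfolding U_def[abs_def] using p L that by (intro solves_equation_separable) auto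
    show "v 0 \<in> square_integrable" by (simp add: v_L2)
    show "U e 0 \<in> square_integrable"
      unfolding U[abs_def] using Fsq by (rule square_integrable_cmult)
    have "((\<lambda>t. \<bar>(t + e) powr k - (0 + e) powr k\<bar> * L2_norm F) \<longlongrightarrow>
        \<bar>(0 + e) powr k - (0 + e) powr k\<bar> * L2_norm F) (at_right 0)"
      using that by (intro tendsto_intros) auto
    then show "((\<lambda>t. L2_norm (\<lambda>x. U e t x - U e 0 x)) \<longlongrightarrow> 0) (at_right 0)"
      by (simp add: U L2_norm_cmult_diff)
  qed
  define e where "e n = 1 / real (Suc n)" for n
  have "e n > 0" for n by (simp add: e_def)
  have "(\<lambda>n. (LINT x|lborel. (max 0 (v 0 x - U (e n) 0 x))\<^sup>2)) \<longlonglongrightarrow> (LINT x|(lborel :: 'a measure). 0)"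
  proof (rule integral_dominated_convergence[where w = "\<lambda>x. (v 0 x)\<^sup>2"])
    show "integrable lborel (\<lambda>x. (v 0 x)\<^sup>2)"
      by (intro square_integrable_sq v_L2) simp
    \<comment> \<open>U is nonnegative, so subtracting it cannot enlarge the positive part, whatever
      the sign of \<open>v 0\<close>.\<close>
    show "AE x in lborel. norm ((max 0 (v 0 x - U (e n) 0 x))\<^sup>2) \<le> (v 0 x)\<^sup>2" for n
    proof (rule AE_I2)
      fix x
      have "0 \<le> U (e n) 0 x" by (simp add: U F_nonneg)
      then have "\<bar>max 0 (v 0 x - U (e n) 0 x)\<bar> \<le> \<bar>v 0 x\<bar>" by linarith
      then have "(max 0 (v 0 x - U (e n) 0 x))\<^sup>2 \<le> (v 0 x)\<^sup>2"
        by (rule abs_le_square_iff[THEN iffD1])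
      then show "norm ((max 0 (v 0 x - U (e n) 0 x))\<^sup>2) \<le> (v 0 x)\<^sup>2"
        by simp
    qed
    show "AE x in lborel. (\<lambda>n. (max 0 (v 0 x - U (e n) 0 x))\<^sup>2) \<longlonglongrightarrow> 0"
    proof (rule AE_I2)
      fix x
      show "(\<lambda>n. (max 0 (v 0 x - U (e n) 0 x))\<^sup>2) \<longlonglongrightarrow> 0"
      proof (cases "x \<in> \<Omega>")
        case True
        \<comment> \<open>Since -k > 0, the datum lies below U at x once \<open>v 0 x / F x\<close>
          is at most (n + 1)^(-k), which holds for n >= M^(1/(-k)). The sequence is thus eventually
          0, at an index depending on x; the maximum keeps the base of the power
          nonnegative.\<close>
        define M where "M = max 0 (v 0 x / F x)"
        have "\<forall>\<^sub>F n in sequentially. v 0 x / F x \<le> real (Suc n) powr (- k)"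
          using eventually_ge_at_top[of "nat \<lceil>M powr (1 / - k)\<rceil>"]
        proof eventually_elim
          case (elim n)
          then have "M powr (1 / - k) \<le> real (Suc n)"
            by linarith
          then have "(M powr (1 / - k)) powr (- k) \<le> real (Suc n) powr (- k)"
            using \<open>k < 0\<close> by (intro powr_mono2) auto
          moreover have "(M powr (1 / - k)) powr (- k) = M"
            using \<open>k < 0\<close> by (simp add: powr_powr M_def)
          ultimately show ?case by (simp add: M_def)
        qed
        then have "\<forall>\<^sub>F n in sequentially. (max 0 (v 0 x - U (e n) 0 x))\<^sup>2 = 0"
        proof eventually_elim
          case (elim n)
          have "e n powr k = real (Suc n) powr (- k)"
            unfolding e_def by (simp add: powr_divide powr_minus inverse_eq_divide)
          then have "v 0 x \<le> U (e n) 0 x"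
            using elim pos[OF True] by (simp add: U field_simps)
          then show ?case by simp
        qed
        then show ?thesis by (rule tendsto_eventually)
      next
        case False
        then show ?thesis using v_out[of 0 x] F0 by (simp add: U)
      qed
    qed
  qed (auto simp: U)
  then have "(\<lambda>n. L2_norm (\<lambda>x. max 0 (v 0 x - U (e n) 0 x))) \<longlonglongrightarrow> sqrt 0"
    unfolding L2_norm_def by (intro tendsto_real_sqrt) simp
  then have lim: "(\<lambda>n. L2_norm (\<lambda>x. max 0 (v 0 x - U (e n) 0 x))) \<longlonglongrightarrow> 0"
    by simp
  define X where "X x = max 0 (v t x - U 0 t x)" for x
  have vt: "v t \<in> square_integrable" using v_L2 \<open>t > 0\<close> by simp
  have Usq: "U e t \<in> square_integrable" for e t
    unfolding U[abs_def] using Fsq by (rule square_integrable_cmult)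
  have Xsq: "X \<in> square_integrable"
    unfolding X_def[abs_def] using vt Usq by (intro square_integrable_intros)
  have "L2_norm X \<le> L2_norm (\<lambda>x. max 0 (v 0 x - U (e n) 0 x))" for n
  proof -
    \<comment> \<open>The unshifted U at time t dominates the shifted one because the exponent k is
      negative, so X is at most the excess that the contraction controls.\<close>
    have "L2_norm X \<le> L2_norm (\<lambda>x. max 0 (v t x - U (e n) t x))"
    proof (rule L2_norm_mono)
      show "(\<lambda>x. max 0 (v t x - U (e n) t x)) \<in> square_integrable"
        using vt Usq by (intro square_integrable_intros)
      fix x
      have "(t + e n) powr k \<le> (t + 0) powr k"
        using \<open>t > 0\<close> \<open>e n > 0\<close> \<open>k < 0\<close> by (intro powr_mono2') auto
      then have "U (e n) t x \<le> U 0 t x"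
        unfolding U by (intro mult_right_mono F_nonneg)
      then show "\<bar>X x\<bar> \<le> \<bar>max 0 (v t x - U (e n) t x)\<bar>"
        by (simp add: X_def)
    qed (rule square_integrable_borel[OF Xsq])
    also have "\<dots> \<le> L2_norm (\<lambda>x. max 0 (v 0 x - U (e n) 0 x))"
      using \<open>e n > 0\<close> by (rule compare)
    finally show ?thesis .
  qed
  then have "L2_norm X \<le> 0"
    by (intro LIMSEQ_le_const[OF lim]) auto
  then have "(LINT x|lborel. (X x)\<^sup>2) = 0"
    using L2_norm_nonneg[of X] L2_norm_power2[of X] by simp
  then have "AE x in lborel. (X x)\<^sup>2 = 0"
    using square_integrable_sq[OF Xsq] by (subst (asm) integral_nonneg_eq_0_iff_AE) auto
  then show ?thesis
    by eventually_elim (simp add: X_def U_def max_def split: if_splits)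
qed

section \<open>Passage from strong solutions to their L1 limits\<close>

lemma Lr_space_2_integrable:
  fixes \<Omega> :: "'a::euclidean_space set"
  assumes f: "f \<in> Lr_space 2 \<Omega>" and "bounded \<Omega>"
  shows "integrable lborel f"
proof -
  obtain r where r: "\<Omega> \<subseteq> cball 0 r"
    using \<open>bounded \<Omega>\<close> by (auto simp: bounded_pos subset_iff)
  have sq: "f \<in> square_integrable" and out: "\<And>x. x \<notin> \<Omega> \<Longrightarrow> f x = 0"
    using f unfolding Lr_space_2_iff by auto
  show ?thesis
  proof (rule Bochner_Integration.integrable_bound)
    show "integrable lborel (\<lambda>x. indicator (cball 0 r) x + (f x)\<^sup>2)"
      using sq emeasure_lborel_cball_finite[of "0::'a" r]
      by (intro Bochner_Integration.integrable_add square_integrable_sq integrable_real_indicator) auto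
    show "f \<in> borel_measurable lborel"
      using square_integrable_borel[OF sq] by simp
    show "AE x in lborel. norm (f x) \<le> norm (indicator (cball 0 r) x + (f x)\<^sup>2)"
    proof (rule AE_I2)
      fix x
      show "norm (f x) \<le> norm (indicator (cball 0 r) x + (f x)\<^sup>2)"
      proof (cases "x \<in> \<Omega>")
        case True
        then have "x \<in> cball 0 r" using r by blast
        have "0 \<le> (\<bar>f x\<bar> - 1)\<^sup>2 + \<bar>f x\<bar>" by simp
        also have "\<dots> = 1 + (f x)\<^sup>2 - \<bar>f x\<bar>"
          by (simp add: power2_diff)
        finally have "\<bar>f x\<bar> \<le> 1 + (f x)\<^sup>2"
          by simp
        then show ?thesis using \<open>x \<in> cball 0 r\<close> by simp
      qed (simp add: out)
    qed
  qed
qed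

lemma Lr_space_1_integrable:
  assumes "f \<in> Lr_space 1 \<Omega>"
  shows "integrable lborel f"
proof -
  have one: "real_of_ereal 1 = 1" "(1::ereal) \<noteq> \<infinity>" by simp_all
  have "integrable lborel (\<lambda>x. \<bar>f x\<bar>)" and f: "f \<in> borel_measurable lborel"
    using assms unfolding Lr_space_def mem_Collect_eq one(1) if_not_P[OF one(2)] by simp_all
  then show ?thesis
    by (rule integrable_abs_cancel)
qed

theorem theorem3p2:
  fixes \<Omega> :: "'a::euclidean_space set" and s p :: real and F :: "'a \<Rightarrow> real"
  assumes "0 < s" and "s < 1" and "2 < p"
    and "smooth_bounded_domain \<Omega>"
    and "frac_p_Laplacian p s \<Omega> F (\<lambda>x. 1 / (p - 2) * F x)"
    and "\<And>x. x \<in> \<Omega> \<Longrightarrow> F x > 0"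
    and "\<And>x. x \<notin> \<Omega> \<Longrightarrow> F x = 0"
  shows "solves_equation p s \<Omega> (separable_solution p F) \<and>
    (\<forall>(r::ereal) u0 u.
       1 \<le> r \<and> u0 \<in> Lr_space r \<Omega> \<and> semigroup_solution p s \<Omega> u0 u \<and>
       (\<forall>t>0. AE x in lborel. x \<in> \<Omega> \<longrightarrow> 0 \<le> u t x) \<longrightarrow>
       (\<forall>t>0. AE x in lborel. x \<in> \<Omega> \<longrightarrow> u t x \<le> separable_solution p F t x))"
proof (intro conjI allI impI)
  show "solves_equation p s \<Omega> (separable_solution p F)"
    using solves_equation_separable[OF assms(3,5), of 0] by simp
next
  fix r :: ereal and u0 u t
  assume *: "1 \<le> r \<and> u0 \<in> Lr_space r \<Omega> \<and> semigroup_solution p s \<Omega> u0 u \<and>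
       (\<forall>t>0. AE x in lborel. x \<in> \<Omega> \<longrightarrow> 0 \<le> u t x)" and "0 < (t::real)"
  obtain v0 v where v: "\<And>n::nat. strong_solution p s \<Omega> (v0 n) (v n)"
    and "\<forall>t\<ge>0. (\<lambda>n. L1_norm (\<lambda>x. v n t x - u t x)) \<longlonglongrightarrow> 0"
    using * unfolding semigroup_solution_def by blast
  then have lim: "(\<lambda>n. L1_norm (\<lambda>x. v n t x - u t x)) \<longlonglongrightarrow> 0"
    using \<open>0 < t\<close> by simp
  have "u t \<in> Lr_space 1 \<Omega>"
    using * \<open>0 < t\<close> unfolding semigroup_solution_def by (meson less_imp_le)
  then have "integrable lborel (u t)"
    by (rule Lr_space_1_integrable)
  moreover have "integrable lborel (v n t)" for n
  proof (rule Lr_space_2_integrable)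
    show "v n t \<in> Lr_space 2 \<Omega>"
      using v[of n] \<open>0 < t\<close> unfolding strong_solution_def by (meson less_imp_le)
    show "bounded \<Omega>"
      using assms(4) unfolding smooth_bounded_domain_def by blast
  qed
  ultimately have int: "integrable lborel (\<lambda>x. v n t x - u t x)" for n
    by simp
  \<comment> \<open>The time is fixed, so a subsequence depending on t is harmless.\<close>
  obtain q where q: "AE x in lborel. (\<lambda>n. v (q n) t x - u t x) \<longlonglongrightarrow> 0"
    using tendsto_L1_AE_subseq[where u = "\<lambda>n x. v n t x - u t x", OF int] lim
    by (auto simp: L1_norm_def)
  \<comment> \<open>Countably many exceptional null sets, one for each approximant, are merged into
    one.\<close>
  have "AE x in lborel. \<forall>n. v (q n) t x \<le> separable_solution p F t x"
    unfolding AE_all_countable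
    using strong_solution_le_separable[OF assms(1-3,5,6) v \<open>0 < t\<close>] by blast
  with q show "AE x in lborel. x \<in> \<Omega> \<longrightarrow> u t x \<le> separable_solution p F t x"
  proof eventually_elim
    case (elim x)
    then have "u t x \<le> separable_solution p F t x"
      by (intro LIMSEQ_le_const2[OF LIM_zero_cancel]) auto
    then show ?case by simp
  qed
qed

end
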